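(* Let $\textnormal{R}\in\{\textnormal{ML},\textnormal{wML},\textnormal{C},\textnormal{CH}\}$, let $\varphi$ be a computable precise forecasting system, and let $\omega\in\Omega$ be a path that is $\textnormal{R}$-random for $\varphi$. Then $I_\textnormal{R}(\omega)=I_\varphi(\omega)$, where $I_\varphi(\omega)=\big[\liminf_{n\to\infty}\underline{\varphi}(\omega_{1:n}),\ \limsup_{n\to\infty}\overline{\varphi}(\omega_{1:n})\big]$.
   Context: $\mathcal{X}=\{0,1\}$; $\Omega=\mathcal{X}^{\mathbb{N}}$ is the set of paths $\omega=(\omega_1,\omega_2,\dots)$; $\mathbb{S}=\bigcup_{n\geq0}\mathcal{X}^n$ is the set of situations (finite binary strings), $\square$ the empty string, $|s|$ the length of $s$, $sx$ concatenation, $\omega_{1:n}=(\omega_1,\dots,\omega_n)$ with $\omega_{1:0}=\square$. $\mathcal{I}$ is the set of nonempty closed intervals $I\subseteq[0,1]$ (interval forecasts). A forecasting system is a map $\varphi:\mathbb{S}\to\mathcal{I}$; $\underline{\varphi}(s)=\min\varphi(s)$, $\overline{\varphi}(s)=\max\varphi(s)$; $\varphi$ is precise if $\underline\varphi=\overline\varphi$. An interval forecast $I$ is identified with the constant forecasting system $s\mapsto I$. A real map $r$ on a countable effectively encoded set $\mathcal D$ is computable if there is a recursive map $q:\mathcal{D}\times\mathbb{N}_0\to\mathbb{Q}$ with $|r(d)-q(d,n)|<2^{-n}$ for all $d,n$; it is lower semicomputable if there is a recursive $q:\mathcal{D}\times\mathbb{N}_0\to\mathbb{Q}$ with $q(d,n+1)\ge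 q(d,n)$ and $r(d)=\lim_n q(d,n)$. $\varphi$ is computable if $\underline\varphi$ and $\overline\varphi$ are computable. For a gamble $f:\mathcal X\to\mathbb R$ and $I\in\mathcal I$, $\overline{E}_I(f)=\max_{p\in I}[pf(1)+(1-p)f(0)]$. A real process $F:\mathbb S\to\mathbb R$ is a supermartingale for $\varphi$ if $\overline{E}_{\varphi(s)}\big(F(s\,\cdot)-F(s)\big)\le 0$ for all $s$; a test supermartingale if moreover $F\ge0$ and $F(\square)=1$. A multiplier process is a map $D$ from $\mathbb S$ to gambles; it generates $D^{\circledcirc}(x_1,\dots,x_n)=\prod_{k=0}^{n-1}D(x_{1:k})(x_{k+1})$; $D$ is lower semicomputable if $(s,x)\mapsto D(s)(x)$ is. Randomness notions (for a path $\omega$ and forecasting system $\varphi$): $\omega$ is ML-random for $\varphi$ if no lower semicomputable test supermartingale $T$ for $\varphi$ satisfies $\limsup_n T(\omega_{1:n})=\infty$; wML-random if no test supermartingale for $\varphi$ of the form $D^{\circledcirc}$ with $D$ a lower semicomputable multiplier process satisfies this; C-random if no computable test supermartingale for $\varphi$ satisfies this. $\omega$ is CH-random for $\varphi$ if for every recursive selection process $S:\mathbb S\to\{0,1\}$ with $\sum_{k=0}^{n-1}S(\omega_{1:k})\to\infty$ we have $\liminf_n \frac{\sum_{k=0}^{n-1}S(\omega_{1:k})[\omega_{k+1}-\underline\varphi(\omega_{1:k})]}{\sum_{k=0}^{n-1}S(\omega_{1:k})}\ge0$ and $\limsup_n \frac{\sum_{k=0}^{n-1}S(\omega_{1:k})[\omega_{k+1}-\overline\varphi(\omega_{1:k})]}{\sum_{k=0}^{n-1}S(\omega_{1:k})}\le0$.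 For a notion R, $\mathcal I_\textnormal{R}(\omega)=\{I\in\mathcal I:\omega \text{ is R-random for } I\}$ and $I_\textnormal{R}(\omega)=\bigcap_{I\in\mathcal I_\textnormal{R}(\omega)} I$. *)

theory Defs
  imports "HOL-Analysis.Analysis" "HOL-Library.Extended_Real"
begin

datatype recf = Zero | Succ | Proj nat | Comp recf "recf list" | PrimRec recf recf | Mu recf

inductive evalr :: "recf \<Rightarrow> nat list \<Rightarrow> nat \<Rightarrow> bool" where
  ev_zero: "evalr Zero xs 0"
| ev_succ: "evalr Succ (x # xs) (Suc x)"
| ev_proj: "i < length xs \<Longrightarrow> evalr (Proj i) xs (xs ! i)"
| ev_comp: "list_all2 (\<lambda>g y. evalr g xs y) gs ys \<Longrightarrow> evalr f ys z \<Longrightarrow> evalr (Comp f gs) xs z"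
| ev_pr0: "evalr f xs y \<Longrightarrow> evalr (PrimRec f g) (0 # xs) y"
| ev_prS: "evalr (PrimRec f g) (n # xs) y \<Longrightarrow> evalr g (y # n # xs) z
           \<Longrightarrow> evalr (PrimRec f g) (Suc n # xs) z"
| ev_mu: "evalr f (n # xs) 0 \<Longrightarrow> (\<forall>m<n. \<exists>y. evalr f (m # xs) (Suc y))
           \<Longrightarrow> evalr (Mu f) xs n"

definition total_rec :: "nat \<Rightarrow> (nat list \<Rightarrow> nat) \<Rightarrow> bool" where
  "total_rec m f \<longleftrightarrow> (\<exists>c. \<forall>xs. length xs = m \<longrightarrow> evalr c xs (f xs))"

text \<open>Situations are finite binary strings, encoded bijectively as naturals
  (bijective base 2).  Outcomes 0/1 are the booleans False/True.\<close>
fun enc_sit :: "bool list \<Rightarrow> nat" where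
  "enc_sit [] = 0"
| "enc_sit (b # s) = 2 * enc_sit s + (if b then 2 else 1)"

definition rec_rat_sit :: "(bool list \<Rightarrow> nat \<Rightarrow> rat) \<Rightarrow> bool" where
  "rec_rat_sit q \<longleftrightarrow> (\<exists>a b c. total_rec 2 a \<and> total_rec 2 b \<and> total_rec 2 c \<and>
     (\<forall>s n. q s n = (of_nat (a [enc_sit s, n]) - of_nat (b [enc_sit s, n]))
                     / (of_nat (c [enc_sit s, n]) + 1)))"

definition rec_rat_sitx :: "(bool list \<Rightarrow> bool \<Rightarrow> nat \<Rightarrow> rat) \<Rightarrow> bool" where
  "rec_rat_sitx q \<longleftrightarrow> (\<exists>a b c. total_rec 3 a \<and> total_rec 3 b \<and> total_rec 3 c \<and>
     (\<forall>s x n. q s x n = (of_nat (a [enc_sit s, of_bool x, n]) - of_nat (b [enc_sit s, of_bool x, n]))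
                     / (of_nat (c [enc_sit s, of_bool x, n]) + 1)))"

definition computable_sit :: "(bool list \<Rightarrow> real) \<Rightarrow> bool" where
  "computable_sit r \<longleftrightarrow> (\<exists>q. rec_rat_sit q \<and>
     (\<forall>s n. \<bar>r s - real_of_rat (q s n)\<bar> < (1/2) ^ n))"

definition lsc_sit :: "(bool list \<Rightarrow> real) \<Rightarrow> bool" where
  "lsc_sit r \<longleftrightarrow> (\<exists>q. rec_rat_sit q \<and> (\<forall>s n. q s (Suc n) \<ge> q s n) \<and>
     (\<forall>s. (\<lambda>n. real_of_rat (q s n)) \<longlonglongrightarrow> r s))"

definition lsc_sitx :: "(bool list \<Rightarrow> bool \<Rightarrow> real) \<Rightarrow> bool" where
  "lsc_sitx r \<longleftrightarrow> (\<exists>q. rec_rat_sitx q \<and> (\<forall>s x n. q s x (Suc n) \<ge> q s x n) \<and>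
     (\<forall>s x. (\<lambda>n. real_of_rat (q s x n)) \<longlonglongrightarrow> r s x))"

definition rec_selection :: "(bool list \<Rightarrow> bool) \<Rightarrow> bool" where
  "rec_selection S \<longleftrightarrow> (\<exists>c. \<forall>s. evalr c [enc_sit s] (of_bool (S s)))"

definition interval_forecast :: "real set \<Rightarrow> bool" where
  "interval_forecast I \<longleftrightarrow> (\<exists>l u. 0 \<le> l \<and> l \<le> u \<and> u \<le> 1 \<and> I = {l..u})"

definition forecasting_system :: "(bool list \<Rightarrow> real set) \<Rightarrow> bool" where
  "forecasting_system \<phi> \<longleftrightarrow> (\<forall>s. interval_forecast (\<phi> s))"

definition fs_lower :: "(bool list \<Rightarrow> real set) \<Rightarrow> bool list \<Rightarrow> real" where
  "fs_lower \<phi> s = Inf (\<phi> s)"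

definition fs_upper :: "(bool list \<Rightarrow> real set) \<Rightarrow> bool list \<Rightarrow> real" where
  "fs_upper \<phi> s = Sup (\<phi> s)"

definition precise :: "(bool list \<Rightarrow> real set) \<Rightarrow> bool" where
  "precise \<phi> \<longleftrightarrow> (\<forall>s. fs_lower \<phi> s = fs_upper \<phi> s)"

definition computable_fs :: "(bool list \<Rightarrow> real set) \<Rightarrow> bool" where
  "computable_fs \<phi> \<longleftrightarrow> computable_sit (fs_lower \<phi>) \<and> computable_sit (fs_upper \<phi>)"

definition upper_exp :: "real set \<Rightarrow> (bool \<Rightarrow> real) \<Rightarrow> real" where
  "upper_exp I f = Sup ((\<lambda>p. p * f True + (1 - p) * f False) ` I)"

definition supermartingale :: "(bool list \<Rightarrow> real set) \<Rightarrow> (bool list \<Rightarrow> real) \<Rightarrow> bool" where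
  "supermartingale \<phi> F \<longleftrightarrow> (\<forall>s. upper_exp (\<phi> s) (\<lambda>x. F (s @ [x]) - F s) \<le> 0)"

definition test_supermartingale :: "(bool list \<Rightarrow> real set) \<Rightarrow> (bool list \<Rightarrow> real) \<Rightarrow> bool" where
  "test_supermartingale \<phi> F \<longleftrightarrow> supermartingale \<phi> F \<and> (\<forall>s. F s \<ge> 0) \<and> F [] = 1"

definition mult_gen :: "(bool list \<Rightarrow> bool \<Rightarrow> real) \<Rightarrow> bool list \<Rightarrow> real" where
  "mult_gen D s = (\<Prod>k<length s. D (take k s) (s ! k))"

definition prefix :: "(nat \<Rightarrow> bool) \<Rightarrow> nat \<Rightarrow> bool list" where
  "prefix \<omega> n = map \<omega> [0..<n]"

definition unbounded_on :: "(bool list \<Rightarrow> real) \<Rightarrow> (nat \<Rightarrow> bool) \<Rightarrow> bool" where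
  "unbounded_on T \<omega> \<longleftrightarrow> limsup (\<lambda>n. ereal (T (prefix \<omega> n))) = \<infinity>"

definition MartinLoef_random :: "(bool list \<Rightarrow> real set) \<Rightarrow> (nat \<Rightarrow> bool) \<Rightarrow> bool" where
  "MartinLoef_random \<phi> \<omega> \<longleftrightarrow> \<not> (\<exists>T. lsc_sit T \<and> test_supermartingale \<phi> T \<and> unbounded_on T \<omega>)"

definition weakMartinLoef_random :: "(bool list \<Rightarrow> real set) \<Rightarrow> (nat \<Rightarrow> bool) \<Rightarrow> bool" where
  "weakMartinLoef_random \<phi> \<omega> \<longleftrightarrow> \<not> (\<exists>D. lsc_sitx D \<and> test_supermartingale \<phi> (mult_gen D)
                                 \<and> unbounded_on (mult_gen D) \<omega>)"

definition computable_random :: "(bool list \<Rightarrow> real set) \<Rightarrow> (nat \<Rightarrow> bool) \<Rightarrow> bool" where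
  "computable_random \<phi> \<omega> \<longleftrightarrow> \<not> (\<exists>T. computable_sit T \<and> test_supermartingale \<phi> T \<and> unbounded_on T \<omega>)"

definition ChurchHall_random :: "(bool list \<Rightarrow> real set) \<Rightarrow> (nat \<Rightarrow> bool) \<Rightarrow> bool" where
  "ChurchHall_random \<phi> \<omega> \<longleftrightarrow> (\<forall>S. rec_selection S \<longrightarrow>
     filterlim (\<lambda>n. \<Sum>k<n. of_bool (S (prefix \<omega> k)) :: real) at_top sequentially \<longrightarrow>
       liminf (\<lambda>n. ereal ((\<Sum>k<n. of_bool (S (prefix \<omega> k)) * (of_bool (\<omega> k) - fs_lower \<phi> (prefix \<omega> k)))
                        / (\<Sum>k<n. of_bool (S (prefix \<omega> k))))) \<ge> 0 \<and>
       limsup (\<lambda>n. ereal ((\<Sum>k<n. of_bool (S (prefix \<omega> k)) * (of_bool (\<omega> k) - fs_upper \<phi> (prefix \<omega> k)))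
                        / (\<Sum>k<n. of_bool (S (prefix \<omega> k))))) \<le> 0)"

datatype rnotion = R_ML | R_wML | R_C | R_CH

fun is_random :: "rnotion \<Rightarrow> (bool list \<Rightarrow> real set) \<Rightarrow> (nat \<Rightarrow> bool) \<Rightarrow> bool" where
  "is_random R_ML \<phi> \<omega> = MartinLoef_random \<phi> \<omega>"
| "is_random R_wML \<phi> \<omega> = weakMartinLoef_random \<phi> \<omega>"
| "is_random R_C \<phi> \<omega> = computable_random \<phi> \<omega>"
| "is_random R_CH \<phi> \<omega> = ChurchHall_random \<phi> \<omega>"

definition I_R :: "rnotion \<Rightarrow> (nat \<Rightarrow> bool) \<Rightarrow> real set" where
  "I_R R \<omega> = \<Inter> {I. interval_forecast I \<and> is_random R (\<lambda>_. I) \<omega>}"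

definition I_phi :: "(bool list \<Rightarrow> real set) \<Rightarrow> (nat \<Rightarrow> bool) \<Rightarrow> real set" where
  "I_phi \<phi> \<omega> = {real_of_ereal (liminf (\<lambda>n. ereal (fs_lower \<phi> (prefix \<omega> n))))
                  .. real_of_ereal (limsup (\<lambda>n. ereal (fs_upper \<phi> (prefix \<omega> n))))}"

end

theory Submission
  imports Defs
begin

text \<open>For rational \<open>r1 < r2\<close> below the lower end of
  an interval \<open>I\<close>, a computable approximation of \<open>\<phi>\<close> yields a recursive selection of
  situations at which \<open>\<phi>\<close> forecasts at most \<open>r1\<close>, containing all those with sufficiently small
  forecasts. If it selected infinitely often along \<open>\<omega>\<close>, then betting on 1 against \<open>\<phi>\<close> and
  on 0 against \<open>I\<close> would give two capitals whose product diverges, so \<open>\<omega>\<close> is not random for both.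
  This, and its mirror image, puts \<open>I\<^sub>\<phi>(\<omega>)\<close> inside every \<open>I\<close> for which \<open>\<omega>\<close> is random.
  Conversely, if \<open>I\<close> contains a neighbourhood of \<open>I\<^sub>\<phi>(\<omega>)\<close> relative to \<open>[0,1]\<close>, it is eventually
  recognised by approximation along \<open>\<omega>\<close> that the forecast lies in \<open>I\<close>; a strategy
  against \<open>I\<close> becomes one against \<open>\<phi>\<close> by starting late and giving up its capital as soon as the
  recognition fails.\<close>

section \<open>Recursive functions\<close>

lemma total_rec_cong:
  assumes "total_rec m f" "\<And>xs. length xs = m \<Longrightarrow> f xs = g xs"
  shows "total_rec m g"
  using assms unfolding total_rec_def by metis

lemma total_rec_comp:
  assumes f: "total_rec (length gs) f" and gs: "\<forall>g\<in>set gs. total_rec m g"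
  shows "total_rec m (\<lambda>xs. f (map (\<lambda>g. g xs) gs))"
proof -
  obtain cf where cf: "evalr cf ys (f ys)" if "length ys = length gs" for ys
    using f unfolding total_rec_def by blast
  have "\<forall>g\<in>set gs. \<exists>c. \<forall>xs. length xs = m \<longrightarrow> evalr c xs (g xs)"
    using gs unfolding total_rec_def .
  \<comment> \<open>A code is chosen for each function rather than for each position, so equal
    entries of \<open>gs\<close> share one code and \<open>map C gs\<close> is the list that
    \<open>ev_comp\<close> needs.\<close>
  then obtain C where C: "\<And>g xs. g \<in> set gs \<Longrightarrow> length xs = m \<Longrightarrow> evalr (C g) xs (g xs)"
    by metis
  have "evalr (Comp cf (map C gs)) xs (f (map (\<lambda>g. g xs) gs))" if "length xs = m" for xs
    by (rule ev_comp[OF _ cf])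
       (auto simp: list_all2_map1 list_all2_map2 C that intro!: list.rel_refl_strong)
  then show ?thesis
    unfolding total_rec_def by blast
qed

lemma total_rec_nth: "i < m \<Longrightarrow> total_rec m (\<lambda>xs. xs ! i)"
  unfolding total_rec_def by (metis ev_proj)

lemma total_rec_Suc:
  assumes "total_rec m f"
  shows "total_rec m (\<lambda>xs. Suc (f xs))"
proof -
  have "total_rec 1 (\<lambda>xs. Suc (xs ! 0))"
    unfolding total_rec_def by (metis One_nat_def Suc_length_conv ev_succ nth_Cons_0)
  then show ?thesis
    using total_rec_comp[of "[f]" "\<lambda>xs. Suc (xs ! 0)" m] assms by simp
qed

lemma total_rec_const: "total_rec m (\<lambda>xs. k)"
proof (induction k)
  case 0
  show ?case unfolding total_rec_def using ev_zero by blast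
qed (rule total_rec_Suc)

text \<open>The recursion equations are demanded only of values on lists of the right length, so
  \<open>h\<close> may be any known function satisfying them, whatever its definition. The step
  \<open>g\<close> receives the previous value before the counter, as in
  \<open>ev_prS\<close>.\<close>

lemma total_rec_primrec:
  assumes f: "total_rec m f" and g: "total_rec (Suc (Suc m)) g"
    and h0: "\<And>xs. length xs = m \<Longrightarrow> h (0 # xs) = f xs"
    and hS: "\<And>n xs. length xs = m \<Longrightarrow> h (Suc n # xs) = g (h (n # xs) # n # xs)"
  shows "total_rec (Suc m) h"
proof -
  obtain cf where cf: "\<And>xs. length xs = m \<Longrightarrow> evalr cf xs (f xs)"
    using f unfolding total_rec_def by blast
  obtain cg where cg: "\<And>xs. length xs = Suc (Suc m) \<Longrightarrow> evalr cg xs (g xs)"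
    using g unfolding total_rec_def by blast
  have "evalr (PrimRec cf cg) (n # xs) (h (n # xs))" if "length xs = m" for n xs
  proof (induction n)
    case 0
    then show ?case using cf[OF that] h0[OF that] by (simp add: ev_pr0)
  next
    case (Suc n)
    then show ?case using cg[of "h (n # xs) # n # xs"] hS[OF that] that
      by (auto intro: ev_prS)
  qed
  then show ?thesis
    unfolding total_rec_def by (metis length_Suc_conv)
qed

lemma total_rec_comp1:
  assumes "total_rec 1 (\<lambda>xs. h (xs ! 0))" "total_rec m f"
  shows "total_rec m (\<lambda>xs. h (f xs))"
  using total_rec_comp[of "[f]" "\<lambda>xs. h (xs ! 0)" m] assms by simp

lemma total_rec_comp2:
  assumes "total_rec 2 (\<lambda>xs. h (xs ! 0) (xs ! 1))" "total_rec m f" "total_rec m g"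
  shows "total_rec m (\<lambda>xs. h (f xs) (g xs))"
  using total_rec_comp[of "[f, g]" "\<lambda>xs. h (xs ! 0) (xs ! 1)" m] assms
  by (simp add: numeral_2_eq_2)

lemma total_rec_primrec1:
  assumes "total_rec 2 (\<lambda>xs. g (xs ! 0) (xs ! 1))" "\<And>n. h (Suc n) = g (h n) n"
  shows "total_rec 1 (\<lambda>xs. h (xs ! 0))"
  using total_rec_primrec[of 0 "\<lambda>_. h 0" "\<lambda>xs. g (xs ! 0) (xs ! 1)" "\<lambda>xs. h (xs ! 0)"]
    total_rec_const assms by (simp add: numeral_2_eq_2)

lemma total_rec_primrec2:
  assumes "total_rec 1 (\<lambda>xs. f (xs ! 0))" "total_rec 3 (\<lambda>xs. g (xs ! 0) (xs ! 1) (xs ! 2))"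
    and "\<And>x. h 0 x = f x" "\<And>n x. h (Suc n) x = g (h n x) n x"
  shows "total_rec 2 (\<lambda>xs. h (xs ! 0) (xs ! 1))"
  using total_rec_primrec[of 1 "\<lambda>xs. f (xs ! 0)" "\<lambda>xs. g (xs ! 0) (xs ! 1) (xs ! 2)"
      "\<lambda>xs. h (xs ! 0) (xs ! 1)"] assms
  by (simp add: numeral_2_eq_2 numeral_3_eq_3)

lemma total_rec_add:
  assumes "total_rec m f" "total_rec m g"
  shows "total_rec m (\<lambda>xs. f xs + g xs)"
proof (rule total_rec_comp2[OF _ assms])
  show "total_rec 2 (\<lambda>xs. xs ! 0 + xs ! 1)"
    by (rule total_rec_primrec2[where f = "\<lambda>x. x" and g = "\<lambda>y n x. Suc y"])
       (auto intro!: total_rec_nth total_rec_Suc)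
qed

lemma total_rec_mult:
  assumes "total_rec m f" "total_rec m g"
  shows "total_rec m (\<lambda>xs. f xs * g xs)"
proof (rule total_rec_comp2[OF _ assms])
  show "total_rec 2 (\<lambda>xs. xs ! 0 * xs ! 1)"
    by (rule total_rec_primrec2[where f = "\<lambda>x. 0" and g = "\<lambda>y n x. x + y"])
       (auto intro!: total_rec_nth total_rec_add total_rec_const)
qed

lemma total_rec_power2:
  assumes "total_rec m f"
  shows "total_rec m (\<lambda>xs. 2 ^ f xs)"
proof (rule total_rec_comp1[OF _ assms])
  show "total_rec 1 (\<lambda>xs. 2 ^ (xs ! 0))"
    by (rule total_rec_primrec1[where g = "\<lambda>y n. 2 * y"])
       (auto intro!: total_rec_nth total_rec_mult total_rec_const)
qed

text \<open>Truncated subtraction iterates the predecessor, with recursion on the subtrahend. The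
  recursion variable has to come first, so the arguments are swapped at the end.\<close>

lemma total_rec_diff:
  assumes "total_rec m f" "total_rec m g"
  shows "total_rec m (\<lambda>xs. f xs - g xs)"
proof -
  have pred: "total_rec 1 (\<lambda>xs. xs ! 0 - 1)"
    by (rule total_rec_primrec1[where g = "\<lambda>y n. n"]) (auto intro!: total_rec_nth)
  have "total_rec 2 (\<lambda>xs. xs ! 1 - xs ! 0)"
    by (rule total_rec_primrec2[where f = "\<lambda>x. x" and g = "\<lambda>y n x. y - 1" and h = "\<lambda>n x. x - n",
          OF _ total_rec_comp1[OF pred]]) (auto intro!: total_rec_nth)
  then show ?thesis
    by (rule total_rec_comp2[where h = "\<lambda>x y. y - x"]) (use assms in auto)
qed

lemma total_rec_not:
  assumes "total_rec m (\<lambda>xs. of_bool (P xs))"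
  shows "total_rec m (\<lambda>xs. of_bool (\<not> P xs))"
  by (rule total_rec_cong[OF total_rec_diff[OF total_rec_const[of _ 1] assms]]) auto

text \<open>Truncated subtraction decides the order: \<open>1 - (x - y)\<close> is 1 exactly when
  \<open>x \<le> y\<close>, and 0 otherwise.\<close>

lemma total_rec_le:
  assumes "total_rec m f" "total_rec m g"
  shows "total_rec m (\<lambda>xs. of_bool (f xs \<le> g xs))"
  by (rule total_rec_cong[OF total_rec_diff[OF total_rec_const[of _ 1] total_rec_diff[OF assms]]])
     auto

lemma total_rec_less:
  assumes "total_rec m f" "total_rec m g"
  shows "total_rec m (\<lambda>xs. of_bool (f xs < g xs))"
  using total_rec_le[OF total_rec_Suc[OF assms(1)] assms(2)] by (simp add: Suc_le_eq)

lemma total_rec_if: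
  assumes P: "total_rec m (\<lambda>xs. of_bool (P xs))" and f: "total_rec m f" and g: "total_rec m g"
  shows "total_rec m (\<lambda>xs. if P xs then f xs else g xs)"
  by (rule total_rec_cong[OF total_rec_add[OF total_rec_mult[OF P f]
          total_rec_mult[OF total_rec_not[OF P] g]]]) simp

text \<open>Powers of 2 suffice as divisors, since only binary digits of codes will be read. Parity
  flips at each successor, the half grows exactly after odd numbers, and halving is then
  iterated.\<close>

lemma total_rec_div_power2:
  assumes "total_rec m f" "total_rec m g"
  shows "total_rec m (\<lambda>xs. f xs div 2 ^ g xs)"
proof -
  have mod2: "total_rec 1 (\<lambda>xs. xs ! 0 mod 2)"
    by (rule total_rec_primrec1[where g = "\<lambda>y n. 1 - y"])
       (intro total_rec_nth total_rec_diff total_rec_const, simp, presburger)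
  have div2: "total_rec 1 (\<lambda>xs. xs ! 0 div 2)"
    by (rule total_rec_primrec1[where g = "\<lambda>y n. y + n mod 2"])
       (intro total_rec_nth total_rec_add total_rec_comp1[OF mod2], simp, simp, presburger)
  have "total_rec 2 (\<lambda>xs. xs ! 1 div 2 ^ (xs ! 0))"
    by (rule total_rec_primrec2[where f = "\<lambda>x. x" and g = "\<lambda>y n x. y div 2"
          and h = "\<lambda>n x. x div 2 ^ n"])
       (auto intro!: total_rec_nth total_rec_comp1[OF div2] simp: div_mult2_eq[symmetric] mult.commute)
  then show ?thesis
    by (rule total_rec_comp2[where h = "\<lambda>x y. y div 2 ^ x"]) (use assms in auto)
qed

lemma total_rec_mod_power2:
  assumes "total_rec m f" "total_rec m g"
  shows "total_rec m (\<lambda>xs. f xs mod 2 ^ g xs)"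
  by (rule total_rec_cong[OF total_rec_diff[OF assms(1) total_rec_mult[OF
          total_rec_power2[OF assms(2)] total_rec_div_power2[OF assms]]]])
     (simp add: minus_mult_div_eq_mod)

text \<open>The factors may depend on the bound of the product. Recursion needs bound and parameter
  apart, so they are identified only afterwards.\<close>

lemma total_rec_prod:
  assumes "total_rec 2 (\<lambda>xs. f (xs ! 0) (xs ! 1))"
  shows "total_rec 1 (\<lambda>xs. \<Prod>k<xs ! 0. f k (xs ! 0))"
proof -
  have "total_rec 2 (\<lambda>xs. \<Prod>k<xs ! 0. f k (xs ! 1))"
    by (rule total_rec_primrec2[where f = "\<lambda>x. 1" and g = "\<lambda>y n x. y * f n x"
          and h = "\<lambda>n x. \<Prod>k<n. f k x"])
       (auto intro!: total_rec_const total_rec_mult total_rec_comp2[OF assms] total_rec_nth)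
  then show ?thesis
    by (rule total_rec_comp2[where h = "\<lambda>n x. \<Prod>k<n. f k x"]) (auto intro!: total_rec_nth)
qed

lemmas total_rec_intros =
  total_rec_const total_rec_Suc total_rec_add total_rec_mult total_rec_diff total_rec_power2
  total_rec_le total_rec_less total_rec_not total_rec_if
  total_rec_div_power2 total_rec_mod_power2


lemma total_rec_app1:
  assumes "total_rec 1 h" "total_rec m f"
  shows "total_rec m (\<lambda>xs. h [f xs])"
  using total_rec_comp[of "[f]" h m] assms by simp

lemma total_rec_app2:
  assumes "total_rec 2 h" "total_rec m f" "total_rec m g"
  shows "total_rec m (\<lambda>xs. h [f xs, g xs])"
  using total_rec_comp[of "[f, g]" h m] assms by (simp add: numeral_2_eq_2)

lemma total_rec_app3:
  assumes "total_rec 3 h" "total_rec m f" "total_rec m g" "total_rec m k"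
  shows "total_rec m (\<lambda>xs. h [f xs, g xs, k xs])"
  using total_rec_comp[of "[f, g, k]" h m] assms by (simp add: numeral_3_eq_3)


section \<open>Recursive maps on situations\<close>

text \<open>\<open>Suc (enc_sit s)\<close> has the binary digits of \<open>s\<close>, least significant first,
  followed by a leading 1. Hence prefixes and entries of \<open>s\<close> are remainders and
  digits of \<open>Suc (enc_sit s)\<close>.\<close>

lemma Suc_enc_sit_Cons: "Suc (enc_sit (b # s)) = 2 * Suc (enc_sit s) + of_bool b"
  by simp

lemma Suc_enc_sit_take:
  "k \<le> length s \<Longrightarrow> Suc (enc_sit (take k s)) = 2 ^ k + Suc (enc_sit s) mod 2 ^ k"
proof (induction s arbitrary: k)
  case (Cons b s)
  show ?case
  proof (cases k)
    case (Suc j)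
    have "(2 * x + of_bool b) mod 2 ^ Suc j = 2 * (x mod 2 ^ j) + of_bool b" for x :: nat
      using mod_mult2_eq[of "2 * x + of_bool b" 2 "2 ^ j"] by auto
    then show ?thesis
      using Cons.IH[of j] Cons.prems by (simp only: Suc Suc_enc_sit_Cons take_Suc_Cons) simp
  qed simp
qed simp

lemma Suc_enc_sit_div:
  "k \<le> length s \<Longrightarrow> Suc (enc_sit s) div 2 ^ k = Suc (enc_sit (drop k s))"
proof (induction s arbitrary: k)
  case (Cons b s)
  show ?case
  proof (cases k)
    case (Suc j)
    have "(2 * x + of_bool b) div 2 ^ Suc j = x div 2 ^ j" for x :: nat
      using div_mult2_eq[of "2 * x + of_bool b" 2 "2 ^ j"] by auto
    then show ?thesis
      using Cons.IH[of j] Cons.prems by (simp only: Suc Suc_enc_sit_Cons drop_Suc_Cons) simp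
  qed simp
qed simp

lemma enc_sit_nth:
  assumes "k < length s"
  shows "Suc (enc_sit s) div 2 ^ k mod 2 = of_bool (s ! k)"
proof -
  have "Suc (enc_sit s) div 2 ^ k = Suc (enc_sit (s ! k # drop (Suc k) s))"
    using assms by (simp only: Suc_enc_sit_div Cons_nth_drop_Suc less_imp_le)
  then show ?thesis
    by (simp only: Suc_enc_sit_Cons) simp
qed

text \<open>\<open>Suc (enc_sit s)\<close> has exactly \<open>length s + 1\<close> binary digits.
  Lengths can therefore be compared on codes without being computed.\<close>

lemma length_le_iff_enc_sit: "k \<le> length s \<longleftrightarrow> 2 ^ k \<le> Suc (enc_sit s)"
proof -
  have bounds: "2 ^ length s \<le> Suc (enc_sit s)" "Suc (enc_sit s) < 2 ^ Suc (length s)"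
    by (induction s) auto
  show ?thesis
  proof
    assume "k \<le> length s"
    then show "2 ^ k \<le> Suc (enc_sit s)"
      using power_increasing[of k "length s" "2 :: nat"] bounds(1) by linarith
  next
    assume "2 ^ k \<le> Suc (enc_sit s)"
    then have "(2 :: nat) ^ k < 2 ^ Suc (length s)"
      using bounds(2) by linarith
    then show "k \<le> length s"
      by (simp only: power_strict_increasing_iff one_less_numeral_iff semiring_norm less_Suc_eq_le)
  qed
qed

section \<open>Recursive maps and predicates acting through codes\<close>

definition rec_sit :: "(bool list \<Rightarrow> nat) \<Rightarrow> bool" where
  "rec_sit f \<longleftrightarrow> (\<exists>h. total_rec 1 h \<and> (\<forall>s. h [enc_sit s] = f s))"

definition rec_sitx :: "(bool list \<Rightarrow> bool \<Rightarrow> nat) \<Rightarrow> bool" where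
  "rec_sitx f \<longleftrightarrow> (\<exists>h. total_rec 2 h \<and> (\<forall>s x. h [enc_sit s, of_bool x] = f s x))"

abbreviation rec_pred :: "(bool list \<Rightarrow> bool) \<Rightarrow> bool" where
  "rec_pred P \<equiv> rec_sit (\<lambda>s. of_bool (P s))"

lemma rec_sitx_of_rec_sit:
  assumes "rec_sit f"
  shows "rec_sitx (\<lambda>s x. f s)"
proof -
  obtain h where "total_rec 1 h" "\<And>s. h [enc_sit s] = f s"
    using assms unfolding rec_sit_def by auto
  then show ?thesis
    unfolding rec_sitx_def
    by (intro exI[of _ "\<lambda>xs. h [xs ! 0]"]) (auto intro!: total_rec_app1 total_rec_nth)
qed

lemma rec_sitx_outcome_cases:
  assumes "rec_pred S"
  shows "rec_sitx (\<lambda>s x. if S s then if x then i else j else k)"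
proof -
  obtain h where "total_rec 1 h" "\<And>s. h [enc_sit s] = of_bool (S s)"
    using assms unfolding rec_sit_def by auto
  then show ?thesis
    unfolding rec_sitx_def
    by (intro exI[of _ "\<lambda>xs. if 0 < h [xs ! 0] then if 0 < xs ! 1 then i else j else k"])
       (auto intro!: total_rec_intros total_rec_app1 total_rec_nth)
qed

lemma rec_sitx_const: "rec_sitx (\<lambda>s x. k)"
  unfolding rec_sitx_def by (intro exI[of _ "\<lambda>xs. k"]) (simp add: total_rec_const)

lemma rec_pred_length_less: "rec_pred (\<lambda>s. length s < N)"
  unfolding rec_sit_def linorder_not_le[symmetric] length_le_iff_enc_sit
  by (intro exI[of _ "\<lambda>xs. of_bool (\<not> 2 ^ N \<le> Suc (xs ! 0))"])
     (auto intro!: total_rec_intros total_rec_nth)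

lemma rec_pred_conj:
  assumes "rec_pred P" "rec_pred Q"
  shows "rec_pred (\<lambda>s. P s \<and> Q s)"
proof -
  obtain p q where "total_rec 1 p" "\<And>s. p [enc_sit s] = of_bool (P s)"
    "total_rec 1 q" "\<And>s. q [enc_sit s] = of_bool (Q s)"
    using assms unfolding rec_sit_def by auto
  then show ?thesis
    unfolding rec_sit_def
    by (intro exI[of _ "\<lambda>xs. p xs * q xs"]) (auto intro!: total_rec_intros)
qed

lemma rec_pred_not:
  assumes "rec_pred P"
  shows "rec_pred (\<lambda>s. \<not> P s)"
proof -
  obtain p where "total_rec 1 p" "\<And>s. p [enc_sit s] = of_bool (P s)"
    using assms unfolding rec_sit_def by auto
  then show ?thesis
    unfolding rec_sit_def
    by (intro exI[of _ "\<lambda>xs. 1 - p xs"]) (auto intro!: total_rec_diff total_rec_const)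
qed

lemma rec_selection_if_rec_pred: "rec_pred S \<Longrightarrow> rec_selection S"
  unfolding rec_sit_def rec_selection_def total_rec_def by (metis One_nat_def length_Cons list.size(3))

text \<open>This closure property yields both generated capital processes and conditions on all
  prefixes. The product can run up to the code instead of the length, because
  \<open>length s \<le> enc_sit s\<close> and the surplus factors are set to 1.\<close>

lemma rec_sit_prefix_prod:
  assumes "rec_sitx f"
  shows "rec_sit (\<lambda>s. \<Prod>k<length s. f (take k s) (s ! k))"
proof -
  obtain g where g: "total_rec 2 g" "\<And>s x. g [enc_sit s, of_bool x] = f s x"
    using assms unfolding rec_sitx_def by auto
  \<comment> \<open>The test says that position \<open>k\<close> exists in the situation with code
    \<open>e\<close>. The two arguments of \<open>g\<close> are then the code of its prefix of
    length \<open>k\<close>, where the final \<open>- 1\<close> undoes \<open>Suc\<close>, and its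
    entry at \<open>k\<close>.\<close>
  define F where "F = (\<lambda>k e. if 2 ^ Suc k \<le> Suc e
    then g [2 ^ k + Suc e mod 2 ^ k - 1, Suc e div 2 ^ k mod 2 ^ 1] else 1)"
  have "total_rec 1 (\<lambda>xs. \<Prod>k<xs ! 0. F k (xs ! 0))"
    unfolding F_def
    by (rule total_rec_prod) (intro total_rec_intros total_rec_app2 g total_rec_nth, auto)
  moreover have "(\<Prod>k<enc_sit s. F k (enc_sit s)) = (\<Prod>k<length s. f (take k s) (s ! k))" for s
  proof -
    have len: "length s \<le> enc_sit s"
      by (induction s) auto
    have F_less: "F k (enc_sit s) = f (take k s) (s ! k)" if "k < length s" for k
    proof -
      have "2 ^ Suc k \<le> Suc (enc_sit s)"
        using that length_le_iff_enc_sit[of "Suc k" s] by simp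
      then show ?thesis
        unfolding F_def using that Suc_enc_sit_take[of k s, symmetric] enc_sit_nth[of k s]
        by (simp add: g(2))
    qed
    have F_ge: "F k (enc_sit s) = 1" if "\<not> k < length s" for k
      using that length_le_iff_enc_sit[of "Suc k" s] by (auto simp: F_def)
    have "(\<Prod>k<enc_sit s. F k (enc_sit s)) = (\<Prod>k<length s. F k (enc_sit s))"
      by (rule prod.mono_neutral_right) (use len F_ge in auto)
    then show ?thesis
      by (simp add: F_less)
  qed
  ultimately show ?thesis
    unfolding rec_sit_def by (intro exI[of _ "\<lambda>xs. \<Prod>k<xs ! 0. F k (xs ! 0)"]) simp
qed

text \<open>A conjunction over prefixes is a product of truth values.\<close>

lemma rec_pred_prefix_all:
  assumes "rec_pred P"
  shows "rec_pred (\<lambda>s. \<forall>k<length s. P (take k s))"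
proof -
  have "(\<Prod>k<length s. of_bool (P (take k s))) = (of_bool (\<forall>k<length s. P (take k s)) :: nat)" for s
    by (auto simp: prod_zero_iff)
  then show ?thesis
    using rec_sit_prefix_prod[OF rec_sitx_of_rec_sit[OF assms]] by simp
qed

section \<open>Recursive rational-valued maps\<close>

lemma rec_rat_sitI:
  assumes "total_rec 2 a" "total_rec 2 b" "total_rec 2 c"
    and "\<And>s n. q s n = (of_nat (a [enc_sit s, n]) - of_nat (b [enc_sit s, n]))
                     / (of_nat (c [enc_sit s, n]) + 1)"
  shows "rec_rat_sit q"
  unfolding rec_rat_sit_def using assms by blast

lemma rec_rat_sitxI:
  assumes "total_rec 3 a" "total_rec 3 b" "total_rec 3 c"
    and "\<And>s x n. q s x n = (of_nat (a [enc_sit s, of_bool x, n]) - of_nat (b [enc_sit s, of_bool x, n]))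
                     / (of_nat (c [enc_sit s, of_bool x, n]) + 1)"
  shows "rec_rat_sitx q"
  unfolding rec_rat_sitx_def using assms by blast

lemma rec_rat_sit_quotient:
  assumes "rec_sit f" "rec_sit g" "\<And>s. g s > 0"
  shows "rec_rat_sit (\<lambda>s n. of_nat (f s) / of_nat (g s))"
proof -
  obtain a c where a: "total_rec 1 a" "\<And>s. a [enc_sit s] = f s"
    and c: "total_rec 1 c" "\<And>s. c [enc_sit s] = g s"
    using assms unfolding rec_sit_def by auto
  show ?thesis
    \<comment> \<open>The required format adds 1 to the denominator, so \<open>g s - 1\<close> is
      supplied; positivity of \<open>g s\<close> makes this exact.\<close>
    by (rule rec_rat_sitI[of "\<lambda>xs. a [xs ! 0]" "\<lambda>xs. 0"
          "\<lambda>xs. c [xs ! 0] - 1"])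
       (use assms(3) in \<open>auto intro!: total_rec_app1 total_rec_const total_rec_diff total_rec_nth a c
          simp: a c of_nat_diff Suc_le_eq\<close>)
qed

lemma rec_rat_sitx_quotient:
  assumes "rec_sitx f"
  shows "rec_rat_sitx (\<lambda>s x n. of_nat (f s x) / of_nat (Suc m))"
proof -
  obtain a where a: "total_rec 2 a" "\<And>s x. a [enc_sit s, of_bool x] = f s x"
    using assms unfolding rec_sitx_def by auto
  show ?thesis
    by (rule rec_rat_sitxI[of "\<lambda>xs. a [xs ! 0, xs ! 1]" "\<lambda>xs. 0"
          "\<lambda>xs. m"])
       (auto intro!: total_rec_app2 total_rec_const total_rec_nth a simp: a add.commute)
qed

text \<open>Dividing a fraction with denominator \<open>c + 1\<close> by \<open>Suc m\<close> gives
  a denominator that is again one more than a recursive number.\<close>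

lemma of_nat_mult_Suc_add:
  "(of_nat (c * Suc m + m) :: rat) + 1 = (of_nat c + 1) * of_nat (Suc m)"
  by (simp add: algebra_simps)

lemma rec_rat_sit_cases:
  assumes q: "rec_rat_sit q" and "rec_pred P" "rec_pred Q"
  shows "rec_rat_sit (\<lambda>s n. if P s then 1 else if Q s then q s n / of_nat (Suc m) else 0)"
proof -
  obtain a b c where abc: "total_rec 2 a" "total_rec 2 b" "total_rec 2 c"
    and qeq: "\<And>s n. q s n = (of_nat (a [enc_sit s, n]) - of_nat (b [enc_sit s, n]))
                     / (of_nat (c [enc_sit s, n]) + 1)"
    using q unfolding rec_rat_sit_def by auto
  obtain p where p: "total_rec 1 p" "\<And>s. p [enc_sit s] = of_bool (P s)"
    using assms unfolding rec_sit_def by auto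
  obtain r where r: "total_rec 1 r" "\<And>s. r [enc_sit s] = of_bool (Q s)"
    using assms unfolding rec_sit_def by auto
  show ?thesis
    by (rule rec_rat_sitI[of
          "\<lambda>xs. if 0 < p [xs ! 0] then 1 else if 0 < r [xs ! 0] then a [xs ! 0, xs ! 1] else 0"
          "\<lambda>xs. if 0 < p [xs ! 0] then 0 else if 0 < r [xs ! 0] then b [xs ! 0, xs ! 1] else 0"
          "\<lambda>xs. if 0 < p [xs ! 0] then 0 else c [xs ! 0, xs ! 1] * Suc m + m"])
       (auto intro!: total_rec_intros total_rec_app1 total_rec_app2 total_rec_nth abc p r
         simp: p r qeq of_nat_mult_Suc_add divide_divide_eq_left simp del: of_nat_Suc of_nat_add of_nat_mult mult_Suc_right)
qed

lemma rec_rat_sitx_cases: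
  assumes q: "rec_rat_sitx q" and "rec_pred P" "rec_pred Q"
  shows "rec_rat_sitx (\<lambda>s x n. if P s then q s x n / of_nat (Suc m) else if Q s then q s x n else 0)"
proof -
  obtain a b c where abc: "total_rec 3 a" "total_rec 3 b" "total_rec 3 c"
    and qeq: "\<And>s x n. q s x n = (of_nat (a [enc_sit s, of_bool x, n]) - of_nat (b [enc_sit s, of_bool x, n]))
                     / (of_nat (c [enc_sit s, of_bool x, n]) + 1)"
    using q unfolding rec_rat_sitx_def by auto
  obtain p where p: "total_rec 1 p" "\<And>s. p [enc_sit s] = of_bool (P s)"
    using assms unfolding rec_sit_def by auto
  obtain r where r: "total_rec 1 r" "\<And>s. r [enc_sit s] = of_bool (Q s)"
    using assms unfolding rec_sit_def by auto
  let ?sel = "\<lambda>h xs. if 0 < p [xs ! 0] then h [xs ! 0, xs ! 1, xs ! 2]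
    else if 0 < r [xs ! 0] then h [xs ! 0, xs ! 1, xs ! 2] else (0 :: nat)"
  show ?thesis
    by (rule rec_rat_sitxI[of "?sel a" "?sel b"
          "\<lambda>xs. if 0 < p [xs ! 0] then c [xs ! 0, xs ! 1, xs ! 2] * Suc m + m
          else c [xs ! 0, xs ! 1, xs ! 2]"])
       (auto intro!: total_rec_intros total_rec_app1 total_rec_app3 total_rec_nth abc p r
         simp: p r qeq of_nat_mult_Suc_add divide_divide_eq_left simp del: of_nat_Suc of_nat_add of_nat_mult mult_Suc_right)
qed

lemma rec_rat_sit_uminus:
  assumes "rec_rat_sit q"
  shows "rec_rat_sit (\<lambda>s n. - q s n)"
proof -
  obtain a b c where "total_rec 2 a" "total_rec 2 b" "total_rec 2 c"
    and qeq: "\<And>s n. q s n = (of_nat (a [enc_sit s, n]) - of_nat (b [enc_sit s, n]))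
                     / (of_nat (c [enc_sit s, n]) + 1)"
    using assms unfolding rec_rat_sit_def by auto
  then show ?thesis
    by (intro rec_rat_sitI[of b a c]) (auto simp: minus_divide_left)
qed

text \<open>Clearing denominators and moving every subtracted term to the other side turns the
  comparison into one between natural numbers, which is decidable.\<close>

lemma rec_pred_rat_less:
  assumes "rec_rat_sit q"
  shows "rec_pred (\<lambda>s. q s n < r)"
proof -
  obtain a b c where abc: "total_rec 2 a" "total_rec 2 b" "total_rec 2 c"
    and qeq: "\<And>s n. q s n = (of_nat (a [enc_sit s, n]) - of_nat (b [enc_sit s, n]))
                     / (of_nat (c [enc_sit s, n]) + 1)"
    using assms unfolding rec_rat_sit_def by auto
  obtain i j where ij: "r = of_int i / of_int j" "j > 0"
    by (metis quotient_of_denom_pos quotient_of_div surj_pair)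
  \<comment> \<open>The numerator \<open>i\<close> is split into its positive and negative parts, at
    least one of which is 0.\<close>
  define i1 i2 k where "i1 = nat i" "i2 = nat (- i)" "k = nat j"
  have r: "r = (of_nat i1 - of_nat i2) / of_nat k" "k > 0"
    using ij by (auto simp: i1_i2_k_def of_nat_nat)
  have *: "(a - b) / (c + 1) < r \<longleftrightarrow> of_nat k * a + of_nat i2 * (c + 1) < of_nat i1 * (c + 1) + of_nat k * b"
    if "c \<ge> 0" for a b c :: rat
    using that r(2) by (simp add: r(1) divide_simps) (simp add: algebra_simps)
  have eq: "q s n < r \<longleftrightarrow> k * a [enc_sit s, n] + i2 * Suc (c [enc_sit s, n])
      < i1 * Suc (c [enc_sit s, n]) + k * b [enc_sit s, n]" for s
    unfolding qeq *[OF of_nat_0_le_iff]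
    by (subst of_nat_less_iff[where 'a = rat, symmetric]) (simp only: of_nat_add of_nat_mult of_nat_Suc ac_simps)
  show ?thesis
    unfolding rec_sit_def eq
    by (intro exI[of _ "\<lambda>xs. of_bool (k * a [xs ! 0, n] + i2 * Suc (c [xs ! 0, n])
      < i1 * Suc (c [xs ! 0, n]) + k * b [xs ! 0, n])"])
       (auto intro!: total_rec_intros total_rec_app2 total_rec_nth abc)
qed

section \<open>Supermartingales and randomness\<close>

text \<open>\<open>Sup\<close> is a genuine least upper bound only for nonempty sets bounded above;
  here boundedness comes from compactness of the interval.\<close>

lemma upper_exp_le_iff:
  assumes "interval_forecast I"
  shows "upper_exp I f \<le> c \<longleftrightarrow> (\<forall>p\<in>I. p * f True + (1 - p) * f False \<le> c)"
proof -
  let ?g = "\<lambda>p. p * f True + (1 - p) * f False"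
  obtain l u where "l \<le> u" and I: "I = {l..u}"
    using assms unfolding interval_forecast_def by auto
  then have "?g ` I \<noteq> {}" by auto
  moreover have "bdd_above (?g ` I)"
    unfolding I by (intro bounded_imp_bdd_above compact_imp_bounded compact_continuous_image
        continuous_intros compact_Icc)
  ultimately show ?thesis
    unfolding upper_exp_def by (simp add: cSup_le_iff)
qed

lemma supermartingale_iff:
  assumes "forecasting_system \<phi>"
  shows "supermartingale \<phi> F \<longleftrightarrow>
    (\<forall>s. \<forall>p\<in>\<phi> s. p * F (s @ [True]) + (1 - p) * F (s @ [False]) \<le> F s)"
  using assms unfolding supermartingale_def forecasting_system_def
  by (simp add: upper_exp_le_iff algebra_simps)

lemma forecasting_system_bounds:
  assumes "forecasting_system \<phi>"
  shows "fs_lower \<phi> s \<in> \<phi> s" "fs_upper \<phi> s \<in> \<phi> s"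
    and "\<phi> s = {fs_lower \<phi> s..fs_upper \<phi> s}" "\<phi> s \<subseteq> {0..1}"
proof -
  obtain l u where "0 \<le> l" "l \<le> u" "u \<le> 1" "\<phi> s = {l..u}"
    using assms unfolding forecasting_system_def interval_forecast_def by blast
  then show "fs_lower \<phi> s \<in> \<phi> s" "fs_upper \<phi> s \<in> \<phi> s"
    "\<phi> s = {fs_lower \<phi> s..fs_upper \<phi> s}" "\<phi> s \<subseteq> {0..1}"
    by (simp_all add: fs_lower_def fs_upper_def)
qed

lemma mult_gen_Nil [simp]: "mult_gen D [] = 1"
  by (simp add: mult_gen_def)

lemma mult_gen_snoc [simp]: "mult_gen D (s @ [x]) = mult_gen D s * D s x"
  by (simp add: mult_gen_def nth_append)

lemma length_prefix [simp]: "length (prefix \<omega> n) = n"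
  by (simp add: prefix_def)

lemma take_prefix [simp]: "k \<le> n \<Longrightarrow> take k (prefix \<omega> n) = prefix \<omega> k"
  by (simp add: prefix_def take_map)

lemma prefix_Suc: "prefix \<omega> (Suc n) = prefix \<omega> n @ [\<omega> n]"
  by (simp add: prefix_def)

lemma mult_gen_mult: "mult_gen (\<lambda>s x. D s x * E s x) s = mult_gen D s * mult_gen E s"
  by (simp add: mult_gen_def prod.distrib)

section \<open>Unbounded capital along a path\<close>

lemma unbounded_on_iff_frequently:
  "unbounded_on T \<omega> \<longleftrightarrow> (\<forall>C. \<exists>\<^sub>F n in sequentially. C < T (prefix \<omega> n))"
proof (intro iffI allI)
  fix C
  assume "unbounded_on T \<omega>"
  then have "\<not> limsup (\<lambda>n. ereal (T (prefix \<omega> n))) \<le> ereal C"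
    unfolding unbounded_on_def by simp
  then have "\<not> (\<forall>\<^sub>F n in sequentially. ereal (T (prefix \<omega> n)) \<le> ereal C)"
    by (rule contrapos_nn) (rule Limsup_bounded)
  then show "\<exists>\<^sub>F n in sequentially. C < T (prefix \<omega> n)"
    by (simp add: not_eventually not_le)
next
  assume frequently: "\<forall>C. \<exists>\<^sub>F n in sequentially. C < T (prefix \<omega> n)"
  show "unbounded_on T \<omega>"
  proof (rule ccontr)
    assume "\<not> ?thesis"
    then obtain C where "limsup (\<lambda>n. ereal (T (prefix \<omega> n))) < ereal C"
      unfolding unbounded_on_def by (metis ereal_dense2 ereal_infty_less(1))
    then have "\<forall>\<^sub>F n in sequentially. T (prefix \<omega> n) < C"
      by (auto dest: Limsup_lessD)
    then have "\<forall>\<^sub>F n in sequentially. \<not> C < T (prefix \<omega> n)"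
      by (rule eventually_mono) simp
    then show False
      using frequently[rule_format, of C] by (simp add: frequently_def)
  qed
qed

text \<open>Finitely many initial values are bounded, so if the whole sequence is not, arbitrarily
  large values recur at arbitrarily late times.\<close>

lemma unbounded_on_if_not_bdd_above:
  assumes "\<not> bdd_above (range (\<lambda>n. T (prefix \<omega> n)))"
  shows "unbounded_on T \<omega>"
  unfolding unbounded_on_iff_frequently
proof
  fix C
  show "\<exists>\<^sub>F n in sequentially. C < T (prefix \<omega> n)"
  proof (rule ccontr)
    assume "\<not> (\<exists>\<^sub>F n in sequentially. C < T (prefix \<omega> n))"
    then obtain N where N: "\<And>n. n \<ge> N \<Longrightarrow> T (prefix \<omega> n) \<le> C"
      unfolding not_frequently eventually_sequentially by (auto simp: not_less)
    have "bdd_above ((\<lambda>n. T (prefix \<omega> n)) ` ({..<N} \<union> {N..}))"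
      unfolding image_Un bdd_above_Un by (auto intro!: bdd_aboveI2[of _ _ C] N)
    moreover have "{..<N} \<union> {N..} = UNIV" by auto
    ultimately show False
      using assms by simp
  qed
qed

lemma unbounded_on_eventually_scale:
  assumes "unbounded_on T \<omega>" "c > 0" "\<And>n. n \<ge> N \<Longrightarrow> T' (prefix \<omega> n) = T (prefix \<omega> n) * c"
  shows "unbounded_on T' \<omega>"
  unfolding unbounded_on_iff_frequently
proof
  fix C
  have "\<exists>\<^sub>F n in sequentially. C / c < T (prefix \<omega> n)"
    using assms(1) unfolding unbounded_on_iff_frequently by blast
  then have "\<exists>\<^sub>F n in sequentially. C / c < T (prefix \<omega> n) \<and> n \<ge> N"
    using eventually_ge_at_top by (rule frequently_eventually_frequently)
  then show "\<exists>\<^sub>F n in sequentially. C < T' (prefix \<omega> n)"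
    by (rule frequently_elim1) (use assms(2,3) in \<open>simp add: pos_divide_less_eq\<close>)
qed

lemma filterlim_count_at_top:
  assumes "infinite {k. P k}"
  shows "filterlim (\<lambda>n. \<Sum>k<n. of_bool (P k) :: real) at_top sequentially"
  unfolding filterlim_at_top
proof
  fix C :: real
  obtain B where B: "finite B" "card B = nat \<lceil>C\<rceil>" "B \<subseteq> {k. P k}"
    using infinite_arbitrarily_large[OF assms] by blast
  obtain N where N: "B \<subseteq> {..<N}"
    using B(1) finite_nat_iff_bounded by blast
  have "C \<le> (\<Sum>k<n. of_bool (P k))" if "n \<ge> N" for n
  proof -
    have "C \<le> (\<Sum>k\<in>B. of_bool (P k))"
      using B(2,3) by (subst sum.cong[of B B _ "\<lambda>_. 1"]) (auto, linarith)
    also have "\<dots> \<le> (\<Sum>k<n. of_bool (P k))"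
      using N that by (intro sum_mono2) auto
    finally show ?thesis .
  qed
  then show "\<forall>\<^sub>F n in sequentially. C \<le> (\<Sum>k<n. of_bool (P k))"
    unfolding eventually_sequentially by blast
qed


section \<open>Selections with separated forecasts\<close>

lemma common_denominator:
  fixes x y :: real
  assumes "x \<in> \<rat>" "y \<in> \<rat>" "x \<ge> 0" "y \<ge> 0"
  obtains i j m :: nat where "x = real i / real (Suc m)" "y = real j / real (Suc m)"
proof -
  obtain a b where "b \<noteq> 0" "\<bar>x\<bar> = real a / real b"
    using Rats_abs_nat_div_natE[OF assms(1)] by metis
  moreover obtain c d where "d \<noteq> 0" "\<bar>y\<bar> = real c / real d"
    using Rats_abs_nat_div_natE[OF assms(2)] by metis
  ultimately have "x = real (a * d) / real (Suc (b * d - 1))" "y = real (c * b) / real (Suc (b * d - 1))"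
    using assms by auto
  then show thesis by (rule that)
qed

text \<open>Rational multipliers make the capital exactly rational and recursive. It is thus at once
  computable, lower semicomputable and generated by a lower semicomputable multiplier, so a single
  process serves all three notions defined by betting.\<close>

lemma bounded_betting:
  assumes \<phi>: "forecasting_system \<phi>" and S: "rec_pred S"
    and R: "R \<noteq> R_CH" and random: "is_random R \<phi> \<omega>"
    and rat: "\<alpha> \<in> \<rat>" "\<beta> \<in> \<rat>" and nonneg: "\<alpha> \<ge> 0" "\<beta> \<ge> 0"
    and fair: "\<And>s p. S s \<Longrightarrow> p \<in> \<phi> s \<Longrightarrow> p * \<alpha> + (1 - p) * \<beta> \<le> 1"
  shows "bdd_above (range (\<lambda>n. mult_gen (\<lambda>s x. if S s then if x then \<alpha> else \<beta> else 1) (prefix \<omega> n)))"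
proof (rule ccontr)
  define D where "D = (\<lambda>s x. if S s then if x then \<alpha> else \<beta> else 1)"
  assume "\<not> ?thesis"
  then have unbdd: "unbounded_on (mult_gen D) \<omega>"
    unfolding D_def by (rule unbounded_on_if_not_bdd_above)
  have T_nonneg: "mult_gen D s \<ge> 0" for s
    unfolding mult_gen_def D_def using nonneg by (intro prod_nonneg) auto
  have "p * D s True + (1 - p) * D s False \<le> 1" if "p \<in> \<phi> s" for s p
    using fair[of s p] that by (auto simp: D_def)
  then have "mult_gen D s * (p * D s True + (1 - p) * D s False) \<le> mult_gen D s" if "p \<in> \<phi> s" for s p
    using that T_nonneg[of s] by (simp add: mult_left_le)
  then have test: "test_supermartingale \<phi> (mult_gen D)"
    unfolding test_supermartingale_def supermartingale_iff[OF \<phi>]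
    using T_nonneg by (simp add: algebra_simps)
  obtain i j m where ij: "\<alpha> = real i / real (Suc m)" "\<beta> = real j / real (Suc m)"
    using common_denominator rat nonneg by metis
  \<comment> \<open>These are numerators over the common denominator \<open>Suc m\<close>; where no
    bet is placed, the numerator \<open>Suc m\<close> encodes the factor 1.\<close>
  define f where "f = (\<lambda>s x. if S s then if x then i else j else Suc m)"
  have f: "rec_sitx f"
    unfolding f_def by (rule rec_sitx_outcome_cases[OF S])
  have D_eq: "D s x = of_rat (of_nat (f s x) / of_nat (Suc m))" for s x
    by (simp add: D_def f_def ij of_rat_divide del: of_nat_Suc)
  have "lsc_sitx D"
    unfolding lsc_sitx_def D_eq using rec_rat_sitx_quotient[OF f] by (intro exI conjI) auto
  have Suc_m: "rec_sit (\<lambda>s. \<Prod>k<length s. Suc m)"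
    by (rule rec_sit_prefix_prod[OF rec_sitx_const])
  define Q :: "bool list \<Rightarrow> rat" where
    "Q s = of_nat (\<Prod>k<length s. f (take k s) (s ! k)) / of_nat (\<Prod>k<length s. Suc m)" for s
  have Q: "rec_rat_sit (\<lambda>s n. Q s)"
    unfolding Q_def by (intro rec_rat_sit_quotient rec_sit_prefix_prod f Suc_m) auto
  have T_eq: "mult_gen D s = of_rat (Q s)" for s
    by (simp add: Q_def mult_gen_def D_eq of_rat_divide of_rat_power of_rat_prod prod_dividef del: of_nat_Suc)
  have "lsc_sit (mult_gen D)"
    unfolding lsc_sit_def using Q
    by (intro exI[of _ "\<lambda>s n. Q s"]) (simp add: T_eq)
  moreover have "computable_sit (mult_gen D)"
    unfolding computable_sit_def using Q
    by (intro exI[of _ "\<lambda>s n. Q s"]) (simp add: T_eq)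
  ultimately show False
    using R random test unbdd \<open>lsc_sitx D\<close>
    by (cases R) (auto simp: MartinLoef_random_def weakMartinLoef_random_def computable_random_def)
qed

lemma liminf_ereal_ge_0_iff:
  "0 \<le> liminf (\<lambda>n. ereal (X n)) \<longleftrightarrow> (\<forall>e>0. \<forall>\<^sub>F n in sequentially. - e < X n)"
  unfolding le_Liminf_iff
proof (intro iffI allI impI)
  fix e :: real assume *: "\<forall>y<0. \<forall>\<^sub>F n in sequentially. y < ereal (X n)" and "e > 0"
  then show "\<forall>\<^sub>F n in sequentially. - e < X n"
    using *[rule_format, of "ereal (- e)"] by simp
next
  fix y :: ereal assume *: "\<forall>e>0. \<forall>\<^sub>F n in sequentially. - e < X n" and "y < 0"
  then show "\<forall>\<^sub>F n in sequentially. y < ereal (X n)"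
    using *[rule_format, of "- real_of_ereal y"] by (cases y) auto
qed

lemma limsup_ereal_le_0_iff:
  "limsup (\<lambda>n. ereal (X n)) \<le> 0 \<longleftrightarrow> (\<forall>e>0. \<forall>\<^sub>F n in sequentially. X n < e)"
  unfolding Limsup_le_iff
proof (intro iffI allI impI)
  fix e :: real assume *: "\<forall>y>0. \<forall>\<^sub>F n in sequentially. ereal (X n) < y" and "e > 0"
  then show "\<forall>\<^sub>F n in sequentially. X n < e"
    using *[rule_format, of "ereal e"] by simp
next
  fix y :: ereal assume *: "\<forall>e>0. \<forall>\<^sub>F n in sequentially. X n < e" and "y > 0"
  then show "\<forall>\<^sub>F n in sequentially. ereal (X n) < y"
    using *[rule_format, of "real_of_ereal y"] by (cases y) auto
qed

text \<open>The average of the selected outcomes would have to be asymptotically at most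
  \<open>r1\<close> by randomness for the first system and at least \<open>r2\<close> by randomness
  for the second.\<close>

lemma CH_random_not_separated:
  assumes fs1: "forecasting_system \<phi>1" and fs2: "forecasting_system \<phi>2"
    and S: "rec_pred S" and inf: "infinite {n. S (prefix \<omega> n)}" and "r1 < r2"
    and upper: "\<And>s p. S s \<Longrightarrow> p \<in> \<phi>1 s \<Longrightarrow> p \<le> r1"
    and lower: "\<And>s p. S s \<Longrightarrow> p \<in> \<phi>2 s \<Longrightarrow> r2 \<le> p"
    and R1: "ChurchHall_random \<phi>1 \<omega>" and R2: "ChurchHall_random \<phi>2 \<omega>"
  shows False
proof -
  define N where "N = (\<lambda>n. \<Sum>k<n. of_bool (S (prefix \<omega> k)) :: real)"
  define A where "A = (\<lambda>n. \<Sum>k<n. of_bool (S (prefix \<omega> k)) * (of_bool (\<omega> k) - fs_upper \<phi>1 (prefix \<omega> k)))"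
  define B where "B = (\<lambda>n. \<Sum>k<n. of_bool (S (prefix \<omega> k)) * (of_bool (\<omega> k) - fs_lower \<phi>2 (prefix \<omega> k)))"
  \<comment> \<open>Half the gap: the two strict errors together stay below
    \<open>r2 - r1\<close>.\<close>
  define e where "e = (r2 - r1) / 2"
  have "e > 0" using \<open>r1 < r2\<close> by (simp add: e_def)
  have N: "filterlim N at_top sequentially"
    unfolding N_def by (rule filterlim_count_at_top[OF inf])
  have "limsup (\<lambda>n. ereal (A n / N n)) \<le> 0" "0 \<le> liminf (\<lambda>n. ereal (B n / N n))"
    using R1 R2 rec_selection_if_rec_pred[OF S] N
    unfolding ChurchHall_random_def A_def B_def N_def by blast+
  then have "\<forall>\<^sub>F n in sequentially. A n / N n < e" "\<forall>\<^sub>F n in sequentially. - e < B n / N n"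
    unfolding limsup_ereal_le_0_iff liminf_ereal_ge_0_iff using \<open>e > 0\<close> by auto
  moreover have "\<forall>\<^sub>F n in sequentially. 1 \<le> N n"
    using N unfolding filterlim_at_top by blast
  ultimately have "\<forall>\<^sub>F n in sequentially. A n / N n < e \<and> - e < B n / N n \<and> 1 \<le> N n"
    by eventually_elim simp
  then obtain n where n: "A n / N n < e" "- e < B n / N n" "1 \<le> N n"
    using eventually_happens'[OF sequentially_bot] by blast
  \<comment> \<open>The outcomes cancel in \<open>A n - B n\<close>, leaving only differences of
    forecasts at selected situations.\<close>
  have "(r2 - r1) * N n \<le> A n - B n"
    unfolding A_def B_def N_def sum_distrib_left sum_subtractf[symmetric]
  proof (rule sum_mono)
    fix k
    show "(r2 - r1) * of_bool (S (prefix \<omega> k)) \<le>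
      of_bool (S (prefix \<omega> k)) * (of_bool (\<omega> k) - fs_upper \<phi>1 (prefix \<omega> k)) -
      of_bool (S (prefix \<omega> k)) * (of_bool (\<omega> k) - fs_lower \<phi>2 (prefix \<omega> k))"
      using upper[OF _ forecasting_system_bounds(2)[OF fs1]]
        lower[OF _ forecasting_system_bounds(1)[OF fs2]]
      by (cases "S (prefix \<omega> k)") (auto, smt (verit))
  qed
  moreover have "A n < e * N n" "- e * N n < B n"
    using n by (auto simp: divide_simps split: if_splits)
  moreover have "(r2 - r1) * N n = 2 * (e * N n)"
    by (simp add: e_def)
  ultimately show False
    by simp
qed

text \<open>Under \<open>\<phi>1\<close> it is fair to bet on outcome 1 at rate \<open>r1\<close>, under \<open>\<phi>2\<close> to bet on
  outcome 0 at rate \<open>r2\<close>. With stakes \<open>(r2 - r1) / 2\<close>, the product of the two multipliers exceeds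
  1 by a fixed amount for either outcome, so both capitals cannot remain bounded.\<close>

lemma not_random_if_separated:
  assumes fs1: "forecasting_system \<phi>1" and fs2: "forecasting_system \<phi>2"
    and S: "rec_pred S" and inf: "infinite {n. S (prefix \<omega> n)}"
    and r: "0 \<le> r1" "r1 < r2" "r2 \<le> 1" "r1 \<in> \<rat>" "r2 \<in> \<rat>"
    and upper: "\<And>s p. S s \<Longrightarrow> p \<in> \<phi>1 s \<Longrightarrow> p \<le> r1"
    and lower: "\<And>s p. S s \<Longrightarrow> p \<in> \<phi>2 s \<Longrightarrow> r2 \<le> p"
    and R1: "is_random R \<phi>1 \<omega>" and R2: "is_random R \<phi>2 \<omega>"
  shows False
proof (cases "R = R_CH")
  case True
  then show ?thesis
    using CH_random_not_separated[OF fs1 fs2 S inf r(2) upper lower] R1 R2 by simp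
next
  case False
  define c where "c = (r2 - r1) / 2"
  define D where "D = (\<lambda>\<alpha> \<beta> s x. if S s then if x then \<alpha> else \<beta> else (1 :: real))"
  define T1 where "T1 = (\<lambda>n. mult_gen (D (1 + c * (1 - r1)) (1 - c * r1)) (prefix \<omega> n))"
  define T2 where "T2 = (\<lambda>n. mult_gen (D (1 - c * (1 - r2)) (1 + c * r2)) (prefix \<omega> n))"
  have c: "c > 0" "c \<le> 1" "c \<in> \<rat>"
    using r by (auto simp: c_def)
  have nonneg: "0 \<le> 1 + c * (1 - r1)" "0 \<le> 1 - c * r1" "0 \<le> 1 - c * (1 - r2)" "0 \<le> 1 + c * r2"
    using c r by (auto intro!: add_nonneg_nonneg mult_nonneg_nonneg mult_le_one)
  have "bdd_above (range T1)"
    unfolding T1_def D_def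
  proof (rule bounded_betting[OF fs1 S False R1])
    fix s p assume "S s" "p \<in> \<phi>1 s"
    then have "c * p \<le> c * r1" using upper c by simp
    then show "p * (1 + c * (1 - r1)) + (1 - p) * (1 - c * r1) \<le> 1"
      by (simp add: algebra_simps)
  qed (use c r nonneg in auto)
  then obtain C1 where C1: "T1 n \<le> C1" for n
    by (auto simp: bdd_above_def)
  have "bdd_above (range T2)"
    unfolding T2_def D_def
  proof (rule bounded_betting[OF fs2 S False R2])
    fix s p assume "S s" "p \<in> \<phi>2 s"
    then have "c * r2 \<le> c * p" using lower c by simp
    then show "p * (1 - c * (1 - r2)) + (1 - p) * (1 + c * r2) \<le> 1"
      by (simp add: algebra_simps)
  qed (use c r nonneg in auto)
  then obtain C2 where C2: "T2 n \<le> C2" for n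
    by (auto simp: bdd_above_def)
  have T_nonneg: "T1 n \<ge> 0" "T2 n \<ge> 0" for n
    unfolding T1_def T2_def mult_gen_def D_def using nonneg by (auto intro!: prod_nonneg)
  \<comment> \<open>Since \<open>r2 - r1 = 2 * c\<close>, the products expand to
    \<open>1 + 2 * c\<^sup>2\<close> minus \<open>c\<^sup>2 * ((1 - r1) * (1 - r2))\<close> or
    \<open>c\<^sup>2 * (r1 * r2)\<close>, and each subtracted term is at most
    \<open>c\<^sup>2\<close>.\<close>
  have gain: "(1 + c * (1 - r1)) * (1 - c * (1 - r2)) \<ge> 1 + c\<^sup>2" "(1 - c * r1) * (1 + c * r2) \<ge> 1 + c\<^sup>2"
  proof -
    have "(1 - r1) * (1 - r2) \<le> 1" "r1 * r2 \<le> 1"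
      using r by (auto intro!: mult_le_one)
    then have "c * c * ((1 - r1) * (1 - r2)) \<le> c * c" "c * c * (r1 * r2) \<le> c * c"
      using mult_left_mono[of _ 1 "c * c"] by auto
    moreover have r2: "r2 = r1 + 2 * c" by (simp add: c_def field_simps)
    ultimately show "(1 + c * (1 - r1)) * (1 - c * (1 - r2)) \<ge> 1 + c\<^sup>2" "(1 - c * r1) * (1 + c * r2) \<ge> 1 + c\<^sup>2"
      by (auto simp: algebra_simps power2_eq_square)
  qed
  \<comment> \<open>Linear growth is enough. The leading 1 keeps the product at least 1, so every
    selection adds at least \<open>c\<^sup>2\<close>; it also makes the final comparison with
    \<open>C1 * C2\<close> strict.\<close>
  have growth: "1 + c\<^sup>2 * (\<Sum>k<n. of_bool (S (prefix \<omega> k))) \<le> T1 n * T2 n" for n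
  proof (induction n)
    case 0
    then show ?case by (simp add: T1_def T2_def prefix_def)
  next
    case (Suc n)
    show ?case
    proof (cases "S (prefix \<omega> n)")
      case True
      have "T1 n * T2 n * (1 + c\<^sup>2) \<le> T1 (Suc n) * T2 (Suc n)"
        using mult_left_mono[OF gain(1), of "T1 n * T2 n"] mult_left_mono[OF gain(2), of "T1 n * T2 n"]
          T_nonneg[of n] True
        by (cases "\<omega> n") (simp_all add: T1_def T2_def D_def prefix_Suc ac_simps)
      moreover have "1 \<le> T1 n * T2 n"
        using Suc by (rule order.trans[rotated]) (simp add: sum_nonneg)
      then have "c\<^sup>2 \<le> T1 n * T2 n * c\<^sup>2"
        using mult_right_mono[of 1 "T1 n * T2 n" "c\<^sup>2"] by simp
      ultimately show ?thesis
        using Suc True by (simp add: algebra_simps)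
    next
      case False
      then show ?thesis
        using Suc by (simp add: T1_def T2_def D_def prefix_Suc)
    qed
  qed
  have "\<forall>\<^sub>F n in sequentially. C1 * C2 / c\<^sup>2 \<le> (\<Sum>k<n. of_bool (S (prefix \<omega> k)))"
    using filterlim_count_at_top[OF inf] unfolding filterlim_at_top by blast
  then obtain n where "C1 * C2 / c\<^sup>2 \<le> (\<Sum>k<n. of_bool (S (prefix \<omega> k)))"
    using eventually_happens'[OF sequentially_bot] by blast
  then have "C1 * C2 \<le> c\<^sup>2 * (\<Sum>k<n. of_bool (S (prefix \<omega> k)))"
    using c(1) by (simp add: pos_divide_le_eq mult.commute)
  also have "\<dots> < T1 n * T2 n"
    using growth[of n] by simp
  also have "\<dots> \<le> C1 * C2"
    using C1[of n] C2[of n] T_nonneg[of n] by (intro mult_mono) auto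
  finally show False by simp
qed


section \<open>Enlarging the forecasts\<close>

text \<open>Only proper prefixes are tested. Whether \<open>s\<close> itself passes the test affects
  the capital after the next outcome, so the decision to stop is taken before that outcome is
  known.\<close>

definition alive :: "nat \<Rightarrow> (bool list \<Rightarrow> bool) \<Rightarrow> bool list \<Rightarrow> bool" where
  "alive N B s \<longleftrightarrow> (\<forall>k<length s. length (take k s) < N \<or> B (take k s))"

lemma alive_snoc: "alive N B (s @ [x]) \<longleftrightarrow> alive N B s \<and> (length s < N \<or> B s)"
  by (auto simp: alive_def less_Suc_eq)

lemma rec_pred_alive:
  assumes "rec_pred B"
  shows "rec_pred (alive N B)"
proof -
  have "rec_pred (\<lambda>s. \<not> (\<not> length s < N \<and> \<not> B s))"
    by (intro rec_pred_not rec_pred_conj rec_pred_length_less assms)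
  then show ?thesis
    unfolding alive_def using rec_pred_prefix_all[of "\<lambda>s. length s < N \<or> B s"] by simp
qed

text \<open>\<open>T\<close> enters only at level \<open>N\<close>, divided by a bound for all its values there. Unlike the real
  number \<open>T (prefix \<omega> N)\<close>, a natural number bound preserves (semi)computability.\<close>

definition delayed_bet :: "nat \<Rightarrow> nat \<Rightarrow> (bool list \<Rightarrow> bool) \<Rightarrow> (bool list \<Rightarrow> real) \<Rightarrow> bool list \<Rightarrow> real" where
  "delayed_bet N M B T s =
    (if length s < N then 1
     else if alive N B s then T s / real (Suc M) else 0)"

text \<open>Before level \<open>N\<close> the capital is 1 and its successors are at most 1. From
  then on, either the test succeeds and fairness for the larger forecast \<open>\<psi> s\<close> is
  inherited by \<open>\<phi> s\<close>, or the capital drops to 0. The condition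
  \<open>N > 0\<close> gives initial capital 1.\<close>

lemma delayed_bet_test_supermartingale:
  assumes \<phi>: "forecasting_system \<phi>" and \<psi>: "forecasting_system \<psi>"
    and B: "\<And>s. B s \<Longrightarrow> \<phi> s \<subseteq> \<psi> s"
    and T: "test_supermartingale \<psi> T" and "N > 0"
    and M: "\<And>s. length s = N \<Longrightarrow> T s \<le> real M"
  shows "test_supermartingale \<phi> (delayed_bet N M B T)"
proof -
  let ?T = "delayed_bet N M B T"
  have T_nonneg: "T s \<ge> 0" for s
    using T by (simp add: test_supermartingale_def)
  have T'_nonneg: "?T s \<ge> 0" for s
    using T_nonneg by (simp add: delayed_bet_def)
  \<comment> \<open>Level \<open>N\<close> is included, since the step from \<open>N - 1\<close> to
    \<open>N\<close> is where the scaled \<open>T\<close> replaces the constant 1.\<close>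
  have T'_le_1: "?T s \<le> 1" if "length s \<le> N" for s
    using that M[of s] by (auto simp: delayed_bet_def divide_simps)
  have "p * ?T (s @ [True]) + (1 - p) * ?T (s @ [False]) \<le> ?T s" if "p \<in> \<phi> s" for s p
  proof (cases "length s < N")
    case True
    have "0 \<le> p" "p \<le> 1"
      using that forecasting_system_bounds(4)[OF \<phi>, of s] by auto
    then have "p * ?T (s @ [True]) + (1 - p) * ?T (s @ [False]) \<le> p * 1 + (1 - p) * 1"
      using True by (intro add_mono mult_left_mono T'_le_1) auto
    then show ?thesis
      using True by (simp add: delayed_bet_def)
  next
    case False
    show ?thesis
    proof (cases "alive N B s \<and> B s")
      case True
      then have "p * T (s @ [True]) + (1 - p) * T (s @ [False]) \<le> T s"
        using T B that unfolding test_supermartingale_def supermartingale_iff[OF \<psi>] by blast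
      then have "(p * T (s @ [True]) + (1 - p) * T (s @ [False])) / real (Suc M) \<le> T s / real (Suc M)"
        by (intro divide_right_mono) auto
      then show ?thesis
        using True False by (simp add: delayed_bet_def alive_snoc add_divide_distrib)
    next
      case False
      then have "?T (s @ [x]) = 0" for x
        using \<open>\<not> length s < N\<close> by (auto simp: delayed_bet_def alive_snoc)
      then show ?thesis
        using T'_nonneg by simp
    qed
  qed
  then show ?thesis
    using T'_nonneg \<open>N > 0\<close>
    by (simp add: test_supermartingale_def supermartingale_iff[OF \<phi>] delayed_bet_def)
qed

lemma delayed_bet_unbounded:
  assumes "unbounded_on T \<omega>" and B: "\<And>n. n \<ge> N \<Longrightarrow> B (prefix \<omega> n)"
  shows "unbounded_on (delayed_bet N M B T) \<omega>"
proof (rule unbounded_on_eventually_scale[OF assms(1)])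
  fix n assume "n \<ge> N"
  then show "delayed_bet N M B T (prefix \<omega> n) = T (prefix \<omega> n) * (1 / real (Suc M))"
    using B by (auto simp: delayed_bet_def alive_def not_less)
qed simp

text \<open>The construction is applied to each rational approximation separately. The resulting
  \<open>q'\<close> serves lower semicomputability and computability alike.\<close>

lemma delayed_bet_rec_rat:
  assumes "rec_rat_sit q" and B: "rec_pred B"
  obtains q' where "rec_rat_sit q'"
    "\<And>s n. real_of_rat (q' s n) = delayed_bet N M B (\<lambda>s. real_of_rat (q s n)) s"
proof
  show "rec_rat_sit (\<lambda>s n. if length s < N then 1 else if alive N B s then q s n / of_nat (Suc M) else 0)"
    by (intro rec_rat_sit_cases rec_pred_length_less rec_pred_alive assms)
  show "real_of_rat (if length s < N then 1 else if alive N B s then q s n / of_nat (Suc M) else 0)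
    = delayed_bet N M B (\<lambda>s. real_of_rat (q s n)) s" for s n
    by (simp add: delayed_bet_def of_rat_divide del: of_nat_Suc)
qed

lemma delayed_bet_lsc:
  assumes "lsc_sit T" "rec_pred B"
  shows "lsc_sit (delayed_bet N M B T)"
proof -
  obtain q where q: "rec_rat_sit q" "\<And>s n. q s n \<le> q s (Suc n)"
    "\<And>s. (\<lambda>n. real_of_rat (q s n)) \<longlonglongrightarrow> T s"
    using assms(1) unfolding lsc_sit_def by auto
  obtain q' where q': "rec_rat_sit q'"
    "\<And>s n. real_of_rat (q' s n) = delayed_bet N M B (\<lambda>s. real_of_rat (q s n)) s"
    using delayed_bet_rec_rat[OF q(1) assms(2)] by blast
  have "real_of_rat (q' s n) \<le> real_of_rat (q' s (Suc n))" for s n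
    using q(2) by (auto simp: q' delayed_bet_def of_rat_less_eq intro!: divide_right_mono)
  moreover have "(\<lambda>n. real_of_rat (q' s n)) \<longlonglongrightarrow> delayed_bet N M B T s" for s
    unfolding q' delayed_bet_def
    by (auto intro!: tendsto_divide q(3) simp del: of_nat_Suc)
  ultimately show ?thesis
    unfolding lsc_sit_def using q'(1) by (auto simp: of_rat_less_eq)
qed

lemma delayed_bet_computable:
  assumes "computable_sit T" "rec_pred B"
  shows "computable_sit (delayed_bet N M B T)"
proof -
  obtain q where q: "rec_rat_sit q" "\<And>s n. \<bar>T s - real_of_rat (q s n)\<bar> < (1/2) ^ n"
    using assms(1) unfolding computable_sit_def by auto
  obtain q' where q': "rec_rat_sit q'"
    "\<And>s n. real_of_rat (q' s n) = delayed_bet N M B (\<lambda>s. real_of_rat (q s n)) s"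
    using delayed_bet_rec_rat[OF q(1) assms(2)] by blast
  \<comment> \<open>Division by a number at least 1 does not increase the error, so the same
    precision index works.\<close>
  have "\<bar>T s / real (Suc M) - real_of_rat (q s n) / real (Suc M)\<bar> < (1/2) ^ n" for s n
  proof -
    have "\<bar>T s / real (Suc M) - real_of_rat (q s n) / real (Suc M)\<bar> = \<bar>T s - real_of_rat (q s n)\<bar> / real (Suc M)"
      by (simp add: diff_divide_distrib[symmetric] abs_divide)
    also have "\<dots> \<le> \<bar>T s - real_of_rat (q s n)\<bar> / 1"
      by (intro divide_left_mono) auto
    finally show ?thesis using q(2)[of s n] by simp
  qed
  then have "\<bar>delayed_bet N M B T s - real_of_rat (q' s n)\<bar> < (1/2) ^ n" for s n
    unfolding q' delayed_bet_def by auto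
  then show ?thesis
    unfolding computable_sit_def using q'(1) by blast
qed

lemma finite_upper_nat_bound:
  fixes f :: "'a \<Rightarrow> real"
  assumes "finite A"
  obtains M :: nat where "\<And>x. x \<in> A \<Longrightarrow> f x \<le> real M"
proof -
  obtain C where "\<And>x. x \<in> A \<Longrightarrow> f x \<le> C"
    using bdd_above_finite[OF finite_imageI[OF assms]] unfolding bdd_above_def by blast
  then have "f x \<le> real (nat \<lceil>C\<rceil>)" if "x \<in> A" for x
    using that real_nat_ceiling_ge[of C] by fastforce
  then show thesis by (rule that)
qed

text \<open>Below level \<open>N\<close> the multiplier is scaled down so that its values are at most 1. This is fair
  for every forecast, and does not require the generated process to be positive.\<close>

lemma weakMartinLoef_random_if_eventually_subset:
  assumes \<phi>: "forecasting_system \<phi>" and \<psi>: "forecasting_system \<psi>"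
    and B_rec: "rec_pred B" and B: "\<And>s. B s \<Longrightarrow> \<phi> s \<subseteq> \<psi> s"
    and B_path: "\<And>n. n \<ge> N \<Longrightarrow> B (prefix \<omega> n)"
    and random: "weakMartinLoef_random \<phi> \<omega>"
  shows "weakMartinLoef_random \<psi> \<omega>"
  unfolding weakMartinLoef_random_def
proof (clarify)
  fix D
  assume D: "lsc_sitx D" "test_supermartingale \<psi> (mult_gen D)" and unbdd: "unbounded_on (mult_gen D) \<omega>"
  have "finite {s :: bool list. length s < N}"
    using finite_lists_length_le[of "UNIV :: bool set" N]
    by (rule finite_subset[rotated]) auto
  then have "finite ({s :: bool list. length s < N} \<times> (UNIV :: bool set))"
    by simp
  then obtain M where "\<And>z. z \<in> {s. length s < N} \<times> UNIV \<Longrightarrow> (\<lambda>(s, x). D s x) z \<le> real M"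
    using finite_upper_nat_bound by blast
  then have M: "D s x \<le> real M" if "length s < N" for s x
    using that by auto
  define w where "w = (\<lambda>s (x :: bool). if length s < N then 1 / real (Suc M) else of_bool (B s))"
  define D' where "D' = (\<lambda>s x. D s x * w s x)"
  have T': "mult_gen D' s = mult_gen D s * mult_gen w s" for s
    unfolding D'_def by (rule mult_gen_mult)
  have T_nonneg: "mult_gen D s \<ge> 0" for s
    using D(2) by (simp add: test_supermartingale_def)
  have w_nonneg: "mult_gen w s \<ge> 0" for s
    unfolding mult_gen_def w_def by (auto intro!: prod_nonneg)
  \<comment> \<open>The nonnegative factor \<open>mult_gen w s\<close> common to both sides is left
    out here and restored afterwards.\<close>
  have "p * (mult_gen D (s @ [True]) * w s True) + (1 - p) * (mult_gen D (s @ [False]) * w s False)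
      \<le> mult_gen D s" if "p \<in> \<phi> s" for s p
  proof (cases "length s < N")
    case True
    have p: "0 \<le> p" "p \<le> 1"
      using that forecasting_system_bounds(4)[OF \<phi>, of s] by auto
    \<comment> \<open>\<open>D s x\<close> may be negative. An upper bound suffices, because the
      product is next multiplied by the nonnegative \<open>mult_gen D s\<close>.\<close>
    have "D s x * w s x \<le> 1" for x
      using M[OF True, of x] True by (simp add: w_def divide_simps)
    then have "mult_gen D (s @ [x]) * w s x \<le> mult_gen D s" for x
      using mult_left_mono[of "D s x * w s x" 1 "mult_gen D s"] T_nonneg by (simp add: mult.assoc)
    then have "p * (mult_gen D (s @ [True]) * w s True) + (1 - p) * (mult_gen D (s @ [False]) * w s False)
      \<le> p * mult_gen D s + (1 - p) * mult_gen D s"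
      using p by (intro add_mono mult_left_mono) auto
    then show ?thesis by (simp add: algebra_simps)
  next
    case False
    then show ?thesis
      using B[of s] that D(2) T_nonneg[of s]
      unfolding test_supermartingale_def supermartingale_iff[OF \<psi>]
      by (cases "B s") (auto simp: w_def simp del: mult_gen_snoc)
  qed
  then have "mult_gen w s * (p * (mult_gen D (s @ [True]) * w s True) + (1 - p) * (mult_gen D (s @ [False]) * w s False))
    \<le> mult_gen w s * mult_gen D s" if "p \<in> \<phi> s" for s p
    using that w_nonneg by (intro mult_left_mono)
  then have test: "test_supermartingale \<phi> (mult_gen D')"
    unfolding test_supermartingale_def supermartingale_iff[OF \<phi>] T'
    using T_nonneg w_nonneg by (simp add: algebra_simps)
  \<comment> \<open>From level \<open>N\<close> on all weights along \<open>\<omega>\<close> are 1,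
    so old and new capital there differ by a fixed factor, which is positive.\<close>
  have w_eq: "mult_gen w (prefix \<omega> n) = mult_gen w (prefix \<omega> N)" if "n \<ge> N" for n
    using that by (induction n rule: dec_induct) (simp_all add: prefix_Suc w_def B_path)
  have w_pos: "mult_gen w (prefix \<omega> N) > 0"
    unfolding mult_gen_def w_def by (auto intro!: prod_pos)
  have unbdd': "unbounded_on (mult_gen D') \<omega>"
  proof (rule unbounded_on_eventually_scale[OF unbdd w_pos])
    fix n assume n: "n \<ge> N"
    show "mult_gen D' (prefix \<omega> n) = mult_gen D (prefix \<omega> n) * mult_gen w (prefix \<omega> N)"
      by (simp add: T' w_eq[OF n])
  qed
  obtain q where q: "rec_rat_sitx q" "\<And>s x n. q s x n \<le> q s x (Suc n)"
    "\<And>s x. (\<lambda>n. real_of_rat (q s x n)) \<longlonglongrightarrow> D s x"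
    using D(1) unfolding lsc_sitx_def by auto
  define q' where "q' = (\<lambda>s x n. if length s < N then q s x n / of_nat (Suc M)
      else if B s then q s x n else 0)"
  have "rec_rat_sitx q'"
    unfolding q'_def by (intro rec_rat_sitx_cases q rec_pred_length_less B_rec)
  moreover have "q' s x n \<le> q' s x (Suc n)" for s x n
    using q(2) by (auto simp: q'_def intro!: divide_right_mono)
  moreover have q'_eq: "real_of_rat (q' s x n) = real_of_rat (q s x n) * w s x" for s x n
    by (simp add: q'_def w_def of_rat_divide del: of_nat_Suc)
  have "(\<lambda>n. real_of_rat (q' s x n)) \<longlonglongrightarrow> D' s x" for s x
    unfolding q'_eq D'_def by (intro tendsto_intros q(3))
  ultimately have "lsc_sitx D'"
    unfolding lsc_sitx_def by auto
  then show False
    using random test unbdd' unfolding weakMartinLoef_random_def by blast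
qed

text \<open>From time \<open>N\<close> on, the bounds of \<open>\<psi>\<close> along the path are no
  stricter than those of \<open>\<phi>\<close>. The first \<open>N\<close> terms can worsen a
  selected sum by at most \<open>N\<close>, which vanishes after division by a count tending to
  infinity.\<close>

lemma CH_random_if_eventually_subset:
  assumes \<phi>: "forecasting_system \<phi>" and \<psi>: "forecasting_system \<psi>"
    and sub: "\<And>n. n \<ge> N \<Longrightarrow> \<phi> (prefix \<omega> n) \<subseteq> \<psi> (prefix \<omega> n)"
    and random: "ChurchHall_random \<phi> \<omega>"
  shows "ChurchHall_random \<psi> \<omega>"
  unfolding ChurchHall_random_def
proof (intro allI impI)
  fix S assume S: "rec_selection S"
    and count: "filterlim (\<lambda>n. \<Sum>k<n. of_bool (S (prefix \<omega> k)) :: real) at_top sequentially"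
  define C where "C = (\<lambda>n. \<Sum>k<n. of_bool (S (prefix \<omega> k)) :: real)"
  define A where "A = (\<lambda>b n. \<Sum>k<n. of_bool (S (prefix \<omega> k)) * (of_bool (\<omega> k) - b (prefix \<omega> k)) :: real)"
  have small: "\<forall>\<^sub>F n in sequentially. real N / C n < e \<and> C n > 0" if "e > 0" for e
  proof -
    have "\<forall>\<^sub>F n in sequentially. real N / e + 1 \<le> C n"
      using count unfolding C_def filterlim_at_top by blast
    then show ?thesis
    proof eventually_elim
      case (elim n)
      have "C n > 0"
        using elim divide_nonneg_pos[of "real N" e] that by linarith
      moreover have "real N / e < C n" using elim by simp
      ultimately show ?case using that by (simp add: divide_simps mult.commute)
    qed
  qed
  \<comment> \<open>Stated for arbitrary bounds \<open>b\<close> and \<open>b'\<close>, so that it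
    covers the lower ends and, with the systems exchanged, the upper ends.\<close>
  have diff: "A b n \<le> A b' n + real N"
    if "\<And>s. 0 \<le> b s \<and> b' s \<le> 1" "\<And>k. k \<ge> N \<Longrightarrow> b' (prefix \<omega> k) \<le> b (prefix \<omega> k)" for b b' n
  proof -
    have "A b n - A b' n = (\<Sum>k<n. of_bool (S (prefix \<omega> k)) * (b' (prefix \<omega> k) - b (prefix \<omega> k)))"
      by (simp add: A_def sum_subtractf[symmetric] algebra_simps)
    also have "\<dots> \<le> (\<Sum>k<n. of_bool (k < N))"
    proof (rule sum_mono)
      fix k
      show "of_bool (S (prefix \<omega> k)) * (b' (prefix \<omega> k) - b (prefix \<omega> k)) \<le> of_bool (k < N)"
        using that(1)[of "prefix \<omega> k"] that(2)[of k] by (auto simp: not_less)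
    qed
    also have "\<dots> = real (card {k. k < n \<and> k < N})"
      by (simp add: of_bool_def sum.If_cases lessThan_def Collect_conj_eq)
    also have "\<dots> \<le> real N"
      using card_mono[of "{..<N}" "{k. k < n \<and> k < N}"] by auto
    finally show ?thesis by simp
  qed
  have bounds: "0 \<le> fs_lower \<rho> s \<and> fs_lower \<rho> s \<le> 1 \<and> 0 \<le> fs_upper \<rho> s \<and> fs_upper \<rho> s \<le> 1"
    if "forecasting_system \<rho>" for \<rho> s
    using forecasting_system_bounds[OF that, of s] by (metis atLeastAtMost_iff subset_iff)
  have "fs_lower \<psi> (prefix \<omega> k) \<le> fs_lower \<phi> (prefix \<omega> k)"
    "fs_upper \<phi> (prefix \<omega> k) \<le> fs_upper \<psi> (prefix \<omega> k)" if "k \<ge> N" for k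
    using sub[OF that] forecasting_system_bounds(1,2)[OF \<phi>] forecasting_system_bounds(3)[OF \<psi>]
    by (metis atLeastAtMost_iff subset_iff)+
  then have le: "A (fs_lower \<phi>) n \<le> A (fs_lower \<psi>) n + real N"
    "A (fs_upper \<psi>) n \<le> A (fs_upper \<phi>) n + real N" for n
    using bounds[OF \<phi>] bounds[OF \<psi>] by (auto intro!: diff)
  have "0 \<le> liminf (\<lambda>n. ereal (A (fs_lower \<phi>) n / C n))" "limsup (\<lambda>n. ereal (A (fs_upper \<phi>) n / C n)) \<le> 0"
    using random S count unfolding ChurchHall_random_def A_def C_def by blast+
  then have ev: "\<forall>\<^sub>F n in sequentially. - e < A (fs_lower \<phi>) n / C n"
    "\<forall>\<^sub>F n in sequentially. A (fs_upper \<phi>) n / C n < e" if "e > 0" for e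
    using that unfolding limsup_ereal_le_0_iff liminf_ereal_ge_0_iff by blast+
  have "\<forall>\<^sub>F n in sequentially. - e < A (fs_lower \<psi>) n / C n" if "e > 0" for e
    using ev(1)[OF half_gt_zero[OF that]] small[OF half_gt_zero[OF that]]
  proof eventually_elim
    case (elim n)
    have "A (fs_lower \<phi>) n / C n \<le> A (fs_lower \<psi>) n / C n + real N / C n"
      using le(1)[of n] elim by (simp add: divide_right_mono flip: add_divide_distrib)
    then show ?case using elim by linarith
  qed
  moreover have "\<forall>\<^sub>F n in sequentially. A (fs_upper \<psi>) n / C n < e" if "e > 0" for e
    using ev(2)[OF half_gt_zero[OF that]] small[OF half_gt_zero[OF that]]
  proof eventually_elim
    case (elim n)
    have "A (fs_upper \<psi>) n / C n \<le> A (fs_upper \<phi>) n / C n + real N / C n"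
      using le(2)[of n] elim by (simp add: divide_right_mono flip: add_divide_distrib)
    then show ?case using elim by linarith
  qed
  ultimately have "0 \<le> liminf (\<lambda>n. ereal (A (fs_lower \<psi>) n / C n))"
    "limsup (\<lambda>n. ereal (A (fs_upper \<psi>) n / C n)) \<le> 0"
    unfolding limsup_ereal_le_0_iff liminf_ereal_ge_0_iff by simp_all
  then show "0 \<le> liminf (\<lambda>n. ereal ((\<Sum>k<n. of_bool (S (prefix \<omega> k)) * (of_bool (\<omega> k) - fs_lower \<psi> (prefix \<omega> k)))
                        / (\<Sum>k<n. of_bool (S (prefix \<omega> k))))) \<and>
       limsup (\<lambda>n. ereal ((\<Sum>k<n. of_bool (S (prefix \<omega> k)) * (of_bool (\<omega> k) - fs_upper \<psi> (prefix \<omega> k)))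
                        / (\<Sum>k<n. of_bool (S (prefix \<omega> k))))) \<le> 0"
    unfolding A_def C_def by (rule conjI)
qed

lemma is_random_if_eventually_subset:
  assumes \<phi>: "forecasting_system \<phi>" and \<psi>: "forecasting_system \<psi>"
    and B_rec: "rec_pred B" and B: "\<And>s. B s \<Longrightarrow> \<phi> s \<subseteq> \<psi> s"
    and B_path: "\<forall>\<^sub>F n in sequentially. B (prefix \<omega> n)"
    and random: "is_random R \<phi> \<omega>"
  shows "is_random R \<psi> \<omega>"
proof -
  obtain N0 where N0: "\<And>n. n \<ge> N0 \<Longrightarrow> B (prefix \<omega> n)"
    using B_path unfolding eventually_sequentially by blast
  define N where "N = Suc N0"
  have N: "N > 0" "\<And>n. n \<ge> N \<Longrightarrow> B (prefix \<omega> n)"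
    using N0 by (auto simp: N_def)
  \<comment> \<open>One transformed process preserves both kinds of effectiveness, which settles
    Martin-Loef and computable randomness together.\<close>
  have delayed: "\<exists>T'. test_supermartingale \<phi> T' \<and> unbounded_on T' \<omega> \<and>
      (lsc_sit T \<longrightarrow> lsc_sit T') \<and> (computable_sit T \<longrightarrow> computable_sit T')"
    if T: "test_supermartingale \<psi> T" "unbounded_on T \<omega>" for T
  proof -
    have "finite {s :: bool list. length s = N}"
      using finite_lists_length_eq[of "UNIV :: bool set" N] by simp
    then obtain M where M: "\<And>s. s \<in> {s. length s = N} \<Longrightarrow> T s \<le> real M"
      using finite_upper_nat_bound[of _ T] by blast
    show ?thesis
    proof (intro exI conjI impI)
      show "test_supermartingale \<phi> (delayed_bet N M B T)"
        by (rule delayed_bet_test_supermartingale[OF \<phi> \<psi> B T(1) N(1)]) (use M in auto)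
      show "unbounded_on (delayed_bet N M B T) \<omega>"
        using T(2) N(2) by (rule delayed_bet_unbounded)
    qed (intro delayed_bet_lsc delayed_bet_computable B_rec; assumption)+
  qed
  show ?thesis
  proof (cases R)
    case R_ML
    show ?thesis
      using random delayed by (simp only: R_ML is_random.simps MartinLoef_random_def) blast
  next
    case R_C
    show ?thesis
      using random delayed by (simp only: R_C is_random.simps computable_random_def) blast
  next
    case R_wML
    with random show ?thesis
      using weakMartinLoef_random_if_eventually_subset[OF \<phi> \<psi> B_rec B N(2)] by simp
  next
    case R_CH
    with random show ?thesis
      using CH_random_if_eventually_subset[OF \<phi> \<psi> B[OF N(2)]] by simp
  qed
qed

section \<open>Approximating computable forecasts\<close>

lemma precise_forecast_eq:
  assumes "forecasting_system \<phi>" "precise \<phi>"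
  shows "\<phi> s = {fs_lower \<phi> s}" "0 \<le> fs_lower \<phi> s" "fs_lower \<phi> s \<le> 1"
  using forecasting_system_bounds[OF assms(1), of s] assms(2) by (auto simp: precise_def)

lemma rational_power_gap:
  fixes x y :: real
  assumes "x < y"
  obtains r :: rat and K :: nat where "x + (1/2) ^ K \<le> of_rat r" "of_rat r + (1/2) ^ K \<le> y"
proof -
  obtain r where r: "x < of_rat r" "of_rat r < y"
    using of_rat_dense[OF assms] by blast
  then obtain K where "(1/2 :: real) ^ K < min (of_rat r - x) (y - of_rat r)"
    using real_arch_pow_inv[of "min (of_rat r - x) (y - of_rat r)" "1/2"] by auto
  then show thesis
    by (intro that[of K r]) auto
qed

text \<open>Whether a computable real lies below a threshold need not be decidable. Comparing an
  approximation of fixed precision with a rational between \<open>x\<close> and \<open>y\<close> is,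
  and it can go either way only for values in the gap.\<close>

lemma rec_pred_approx_less:
  assumes "computable_sit p" "x < y"
  obtains S where "rec_pred S" "\<And>s. S s \<Longrightarrow> p s < y" "\<And>s. p s < x \<Longrightarrow> S s"
proof -
  obtain q where q: "rec_rat_sit q" "\<And>s n. \<bar>p s - real_of_rat (q s n)\<bar> < (1/2) ^ n"
    using assms(1) unfolding computable_sit_def by auto
  obtain r K where r: "x + (1/2) ^ K \<le> of_rat r" "of_rat r + (1/2) ^ K \<le> y"
    using rational_power_gap[OF assms(2)] by blast
  show thesis
  proof (rule that)
    show "rec_pred (\<lambda>s. q s K < r)"
      by (rule rec_pred_rat_less[OF q(1)])
    show "p s < y" if "q s K < r" for s
      using that q(2)[of s K] r(2) of_rat_less[of "q s K" r, where 'a = real] by linarith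
    show "q s K < r" if "p s < x" for s
      using that q(2)[of s K] r(1) of_rat_less[of "q s K" r, where 'a = real] by linarith
  qed
qed

lemma computable_sit_uminus:
  assumes "computable_sit p"
  shows "computable_sit (\<lambda>s. - p s)"
proof -
  obtain q where q: "rec_rat_sit q" "\<And>s n. \<bar>p s - real_of_rat (q s n)\<bar> < (1/2) ^ n"
    using assms unfolding computable_sit_def by auto
  have "\<bar>- p s - real_of_rat (- q s n)\<bar> < (1/2) ^ n" for s n
    using q(2)[of s n] by (simp add: of_rat_minus)
  then show ?thesis
    unfolding computable_sit_def using rec_rat_sit_uminus[OF q(1)] by blast
qed

lemma rec_pred_approx_greater:
  assumes "computable_sit p" "x < y"
  obtains S where "rec_pred S" "\<And>s. S s \<Longrightarrow> x < p s" "\<And>s. y < p s \<Longrightarrow> S s"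
  using rec_pred_approx_less[OF computable_sit_uminus[OF assms(1)], of "- y" "- x"] assms(2)
  by (metis neg_less_iff_less)

section \<open>Comparison of the two intervals\<close>

theorem theorem1:
  fixes R :: rnotion and \<phi> :: "bool list \<Rightarrow> real set" and \<omega> :: "nat \<Rightarrow> bool"
  assumes "forecasting_system \<phi>"
    and "computable_fs \<phi>"
    and "precise \<phi>"
    and "is_random R \<phi> \<omega>"
  shows "I_R R \<omega> = I_phi \<phi> \<omega>"
proof -
  define p where "p = fs_lower \<phi>"
  have p: "\<And>s. \<phi> s = {p s}" "\<And>s. 0 \<le> p s" "\<And>s. p s \<le> 1"
    using precise_forecast_eq[OF assms(1,3)] by (auto simp: p_def)
  have comp: "computable_sit p"
    using assms(2) by (simp add: computable_fs_def p_def)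
  have upper_eq: "fs_upper \<phi> = p"
    using assms(3) by (auto simp: precise_def p_def)
  let ?X = "\<lambda>n. ereal (p (prefix \<omega> n))"
  have lims: "0 \<le> liminf ?X" "liminf ?X \<le> limsup ?X" "limsup ?X \<le> 1"
    using p by (auto intro!: Liminf_bounded Limsup_bounded Liminf_le_Limsup)
  obtain a where a: "liminf ?X = ereal a"
    using lims by (cases "liminf ?X") auto
  obtain b where b: "limsup ?X = ereal b"
    using lims by (cases "limsup ?X") auto
  have ab: "0 \<le> a" "a \<le> b" "b \<le> 1"
    using lims by (simp_all add: a b)
  have I_phi_eq: "I_phi \<phi> \<omega> = {a..b}"
    unfolding I_phi_def upper_eq p_def[symmetric] by (simp add: a b)
  \<comment> \<open>Clipping to \<open>[0,1]\<close> keeps this an interval forecast. The strict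
    slack at both ends leaves room for approximate tests.\<close>
  have enlarged: "I_R R \<omega> \<subseteq> {max 0 l..min 1 u}" if "l < a" "b < u" for l u
  proof -
    define I where "I = {max 0 l..min 1 u}"
    have I: "interval_forecast I"
      unfolding interval_forecast_def I_def using ab that
      by (intro exI[of _ "max 0 l"] exI[of _ "min 1 u"]) auto
    then have \<psi>: "forecasting_system (\<lambda>_. I)"
      by (simp add: forecasting_system_def)
    \<comment> \<open>The tests must accept the path eventually and accept only forecasts inside
      \<open>I\<close>; the gaps from \<open>l\<close> to \<open>l'\<close> and from
      \<open>u'\<close> to \<open>u\<close> absorb their imprecision.\<close>
    obtain l' where l': "l < l'" "l' < a" using dense[OF \<open>l < a\<close>] by blast
    obtain u' where u': "b < u'" "u' < u" using dense[OF \<open>b < u\<close>] by blast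
    obtain L where L: "rec_pred L" "\<And>s. L s \<Longrightarrow> l < p s" "\<And>s. l' < p s \<Longrightarrow> L s"
      using rec_pred_approx_greater[OF comp l'(1)] by blast
    obtain U where U: "rec_pred U" "\<And>s. U s \<Longrightarrow> p s < u" "\<And>s. p s < u' \<Longrightarrow> U s"
      using rec_pred_approx_less[OF comp u'(2)] by blast
    have "\<forall>\<^sub>F n in sequentially. ereal l' < ?X n" "\<forall>\<^sub>F n in sequentially. ?X n < ereal u'"
      using l'(2) u'(1) less_LiminfD[of "ereal l'" sequentially ?X] Limsup_lessD[of sequentially ?X "ereal u'"]
      by (simp_all add: a b)
    then have path: "\<forall>\<^sub>F n in sequentially. L (prefix \<omega> n) \<and> U (prefix \<omega> n)"
      by eventually_elim (use L U in auto)
    have "is_random R (\<lambda>_. I) \<omega>"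
      using rec_pred_conj[OF L(1) U(1)] _ path assms(4)
    proof (rule is_random_if_eventually_subset[OF assms(1) \<psi>])
      fix s assume "L s \<and> U s"
      then show "\<phi> s \<subseteq> I"
        using L(2)[of s] U(2)[of s] p[of s] by (simp add: I_def)
    qed
    then show ?thesis
      using I by (auto simp: I_R_def I_def)
  qed
  have "I_R R \<omega> \<subseteq> {a..b}"
  proof
    fix x assume x: "x \<in> I_R R \<omega>"
    \<comment> \<open>The value \<open>b + 1\<close> is an arbitrary choice above \<open>b\<close>;
      only the lower end of the enlargement is used.\<close>
    have "l \<le> x" if "l < a" for l
      using enlarged[OF that, of "b + 1"] x by auto
    moreover have "x \<le> u" if "b < u" for u
      using enlarged[OF _ that, of "a - 1"] x by auto
    ultimately show "x \<in> {a..b}"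
      by (auto intro: dense_le dense_ge)
  qed
  moreover have "{a..b} \<subseteq> I" if I: "interval_forecast I" and random: "is_random R (\<lambda>_. I) \<omega>" for I
  proof -
    obtain l u where lu: "0 \<le> l" "l \<le> u" "u \<le> 1" "I = {l..u}"
      using I unfolding interval_forecast_def by auto
    have \<psi>: "forecasting_system (\<lambda>_. I)"
      using I by (simp add: forecasting_system_def)
    have "l \<le> a"
    proof (rule ccontr)
      assume "\<not> l \<le> a"
      \<comment> \<open>The order will be \<open>a < t < r1 < r2 < l\<close>. Forecasts below
        \<open>t\<close> recur since \<open>a\<close> is the lower limit, selected forecasts are
        below \<open>r1\<close>, and every element of \<open>I\<close> is above
        \<open>r2\<close>.\<close>
      then obtain r2 where r2: "r2 \<in> \<rat>" "a < r2" "r2 < l"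
        using Rats_dense_in_real[of a l] by auto
      then obtain r1 where r1: "r1 \<in> \<rat>" "a < r1" "r1 < r2"
        using Rats_dense_in_real[of a r2] by auto
      then obtain t where t: "a < t" "t < r1"
        using dense by blast
      obtain S where S: "rec_pred S" "\<And>s. S s \<Longrightarrow> p s < r1" "\<And>s. p s < t \<Longrightarrow> S s"
        using rec_pred_approx_less[OF comp t(2)] by blast
      have "\<not> (\<forall>\<^sub>F n in sequentially. ereal t \<le> ?X n)"
        using Liminf_bounded[of "ereal t" ?X sequentially] t(1) a by auto
      then have "\<exists>\<^sub>F n in sequentially. S (prefix \<omega> n)"
        unfolding not_eventually by (rule frequently_elim1) (simp add: S(3) not_le)
      then have "infinite {n. S (prefix \<omega> n)}"
        by (simp add: frequently_cofinite flip: cofinite_eq_sequentially)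
      then show False
        using not_random_if_separated[OF assms(1) \<psi> S(1), of \<omega> r1 r2 R] assms(4) random
          r1 r2 ab lu S(2) p by fastforce
    qed
    moreover have "b \<le> u"
    proof (rule ccontr)
      assume "\<not> b \<le> u"
      \<comment> \<open>In the mirror image \<open>u < r1 < r2 < t < b\<close>, the constant system
        is the one below \<open>r1\<close> and \<open>\<phi>\<close> the one above
        \<open>r2\<close>.\<close>
      then obtain r1 where r1: "r1 \<in> \<rat>" "u < r1" "r1 < b"
        using Rats_dense_in_real[of u b] by auto
      then obtain r2 where r2: "r2 \<in> \<rat>" "r1 < r2" "r2 < b"
        using Rats_dense_in_real[of r1 b] by auto
      then obtain t where t: "r2 < t" "t < b"
        using dense by blast
      obtain S where S: "rec_pred S" "\<And>s. S s \<Longrightarrow> r2 < p s" "\<And>s. t < p s \<Longrightarrow> S s"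
        using rec_pred_approx_greater[OF comp t(1)] by blast
      have "\<not> (\<forall>\<^sub>F n in sequentially. ?X n \<le> ereal t)"
        using Limsup_bounded[of ?X "ereal t" sequentially] t(2) b by auto
      then have "\<exists>\<^sub>F n in sequentially. S (prefix \<omega> n)"
        unfolding not_eventually by (rule frequently_elim1) (simp add: S(3) not_le)
      then have "infinite {n. S (prefix \<omega> n)}"
        by (simp add: frequently_cofinite flip: cofinite_eq_sequentially)
      then show False
        using not_random_if_separated[OF \<psi> assms(1) S(1), of \<omega> r1 r2 R] assms(4) random
          r1 r2 ab lu S(2) p by fastforce
    qed
    ultimately show ?thesis
      using lu by simp
  qed
  ultimately show ?thesis
    unfolding I_phi_eq by (auto simp: I_R_def)
qed

end
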